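(* Let $F:\mathbb{R}^n\to\mathbb{R}^n$ be a function in $\mathrm{span}(\Phi_{\rm abs})$ (with a fixed evaluation procedure) and let $x^*$ be an isolated root of $F$ in an open neighborhood $\mathcal{D}$ of $x^*$. If the tangent mode piecewise linearization $\lozenge_{x^*}F$ is coherently oriented on $\mathcal{D}$, then there exist radii $r,R>0$ such that for any $\alpha\in(0,1)$ and any $\check x,\hat x\in B_{(1-\alpha)R}(x^* )$ one has $$B_{\alpha r}(0)\subseteq \lozenge_{\check x}^{\hat x}F(\mathcal{D}).$$
   Context: Elemental functions and PCS functions: $\Phi$ is a library of elemental functions consisting of the binary arithmetic operations and unary functions (such as $\sin,\cos,\exp,\log,\dots$), each differentiable with (locally) Lipschitz continuous derivative on its open domain; $\Phi_{\rm abs}=\Phi\cup\{\mathrm{abs}\}$ with $\mathrm{abs}(x)=|x|$. A function $F$ belongs to $\mathrm{span}(\Phi_{\rm abs})$ (is piecewise composite smooth, PCS) if it is computed by an evaluation procedure: a finite sequence of intermediate values $v_i$, beginning with the components of $x$ and ending with the components of $F(x)$, in which each further $v_i$ is $v_j\pm v_k$, $v_j * v_k$, $\varphi_i(v_j)$ with $\varphi_i\in\Phi$ unary, or $\mathrm{abs}(v_j)$ for earlier values $v_j,v_k$ (division is written as multiplication by a reciprocal; constants are allowed). The procedure is assumed well defined near all reference points considered. Tangent mode piecewise linearization at $\mathring x$: let $\mathring v_i$ be the values of the procedure at $\mathring x$. Starting from $\Delta x=x-\mathring x$, set $\Delta v_i=\Delta v_j\pm\Delta v_k$ if $v_i=v_j\pm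 v_k$; $\Delta v_i=\mathring v_j\Delta v_k+\Delta v_j\mathring v_k$ if $v_i=v_j*v_k$; $\Delta v_i=\varphi_i'(\mathring v_j)\Delta v_j$ if $v_i=\varphi_i(v_j)$; $\Delta v_i=|\mathring v_j+\Delta v_j|-|\mathring v_j|$ if $v_i=|v_j|$. The resulting output increment is $\Delta F(\mathring x;\Delta x)$, and $\lozenge_{\mathring x}F(x)=F(\mathring x)+\Delta F(\mathring x;x-\mathring x)$. Secant mode piecewise linearization at $\check x,\hat x$: let $\check v_i,\hat v_i$ be the values of the procedure at $\check x$ and $\hat x$, $\mathring v_i=(\check v_i+\hat v_i)/2$, $\mathring x=(\check x+\hat x)/2$, and $\Delta x=x-\mathring x$. Use the same rules for $\pm$ and $*$; for $v_i=\varphi_i(v_j)$ set $\Delta v_i=\mathring c_{ij}\Delta v_j$ with $\mathring c_{ij}=\varphi_i'(\mathring v_j)$ if $\check v_j=\hat v_j$ and $\mathring c_{ij}=(\hat v_i-\check v_i)/(\hat v_j-\check v_j)$ otherwise; for $v_i=|v_j|$ set $\Delta v_i=|\mathring v_j+\Delta v_j|-\mathring v_i$, where $\mathring v_i=(|\check v_j|+|\hat v_j|)/2$. The output increment is $\Delta F(\check x,\hat x;\Delta x)$, and $\lozenge_{\check x}^{\hat x}F(x)=\tfrac12(F(\check x)+F(\hat x))+\Delta F(\check x,\hat x;x-\mathring x)$. For $\check x=\hat x$ it equals the tangent mode linearization. Both linearizations are continuous piecewise linear functions of $x\in\mathbb{R}^n$. A continuous function $P:\mathbb{R}^n\to\mathbb{R}^n$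 is piecewise linear if there are finitely many affine functions $P_i(x)=A_ix+b_i$ (selection functions) such that at every $x$ the function $P$ coincides with some $P_i$. It is coherently oriented on an open set $U$ if the linear parts $A_i$ of all selection functions that are active on (i.e. coincide with $P$ on) some nonempty open subset of $U$ have determinants of the same nonzero sign. $x^*$ being an isolated root of $F$ in $\mathcal D$ means that $x^*\in\mathcal{D}$ is the only root of $F$ in $\mathcal{D}$. $B_\rho(x)$ denotes the (full-dimensional, open) ball of radius $\rho$ centered at $x$. *)

theory Defs
  imports "HOL-Analysis.Analysis"
begin

section \<open>Elemental functions and evaluation procedures\<close>

text \<open>
  A unary elemental function is given by its domain \<open>D\<close> together with a total function \<open>\<phi>\<close>, of
  which only the restriction to \<open>D\<close> is meaningful. For example the logarithm is \<open>({0<..}, ln)\<close> and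
  the reciprocal is \<open>(- {0}, inverse)\<close>.
\<close>

definition elemental :: "real set \<Rightarrow> (real \<Rightarrow> real) \<Rightarrow> bool" where
  "elemental D \<phi> \<longleftrightarrow>
     open D \<and>
     (\<forall>t\<in>D. \<phi> field_differentiable at t) \<and>
     (\<forall>t\<in>D. \<exists>\<delta>>0. \<exists>L. L-lipschitz_on (ball t \<delta> \<inter> D) (deriv \<phi>))"

text \<open>A library lists the unary elemental functions only: the arithmetic operations are always available.\<close>

definition elemental_library :: "(real set \<times> (real \<Rightarrow> real)) set \<Rightarrow> bool" where
  "elemental_library \<Phi> \<longleftrightarrow> (\<forall>(D, \<phi>)\<in>\<Phi>. elemental D \<phi>)"

text \<open>
  Intermediate values are addressed by their position in the list of all values, the first
  \<open>CARD('n)\<close> positions being the components of the argument. Every instruction appends one value.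
\<close>

datatype instr =
    Const real
  | Add nat nat
  | Sub nat nat
  | Mul nat nat
  | Elem "real set" "real \<Rightarrow> real" nat
  | Abs nat

fun operands :: "instr \<Rightarrow> nat set" where
  "operands (Const c) = {}"
| "operands (Add j k) = {j, k}"
| "operands (Sub j k) = {j, k}"
| "operands (Mul j k) = {j, k}"
| "operands (Elem D \<phi> j) = {j}"
| "operands (Abs j) = {j}"

definition procedure_over ::
    "(real set \<times> (real \<Rightarrow> real)) set \<Rightarrow> nat \<Rightarrow> instr list \<Rightarrow> bool" where
  "procedure_over \<Phi> n p \<longleftrightarrow>
     (\<forall>i<length p. operands (p ! i) \<subseteq> {..<n + i}) \<and>
     (\<forall>D \<phi> j. Elem D \<phi> j \<in> set p \<longrightarrow> (D, \<phi>) \<in> \<Phi>)"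

definition run_procedure :: "(real list \<Rightarrow> instr \<Rightarrow> real) \<Rightarrow> instr list \<Rightarrow> real list \<Rightarrow> real list" where
  "run_procedure step p vs = foldl (\<lambda>ws i. ws @ [step ws i]) vs p"

text \<open>
  The index type of \<open>real ^ 'n\<close> carries no order. Here \<open>e\<close> is an enumeration of it, a bijection from
  \<open>{..<CARD('n)}\<close> onto \<open>UNIV\<close>, which fixes the order in which components are listed.
\<close>

definition inputs :: "(nat \<Rightarrow> 'n::finite) \<Rightarrow> real ^ 'n \<Rightarrow> real list" where
  "inputs e x = map (\<lambda>i. x $ e i) [0..<CARD('n)]"

text \<open>The vector formed by the last \<open>CARD('n)\<close> values.\<close>

definition outputs :: "(nat \<Rightarrow> 'n::finite) \<Rightarrow> real list \<Rightarrow> real ^ 'n" where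
  "outputs e vs = (\<chi> j. vs ! (length vs - CARD('n) + inv_into {..<CARD('n)} e j))"

fun eval_step :: "real list \<Rightarrow> instr \<Rightarrow> real" where
  "eval_step v (Const c) = c"
| "eval_step v (Add j k) = v ! j + v ! k"
| "eval_step v (Sub j k) = v ! j - v ! k"
| "eval_step v (Mul j k) = v ! j * v ! k"
| "eval_step v (Elem D \<phi> j) = \<phi> (v ! j)"
| "eval_step v (Abs j) = \<bar>v ! j\<bar>"

definition proc_values :: "(nat \<Rightarrow> 'n::finite) \<Rightarrow> instr list \<Rightarrow> real ^ 'n \<Rightarrow> real list" where
  "proc_values e p x = run_procedure eval_step p (inputs e x)"

definition proc_defined_at :: "(nat \<Rightarrow> 'n::finite) \<Rightarrow> instr list \<Rightarrow> real ^ 'n \<Rightarrow> bool" where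
  "proc_defined_at e p x \<longleftrightarrow>
     (\<forall>D \<phi> j. Elem D \<phi> j \<in> set p \<longrightarrow> proc_values e p x ! j \<in> D)"

definition computed_by ::
    "(nat \<Rightarrow> 'n::finite) \<Rightarrow> instr list \<Rightarrow> (real ^ 'n \<Rightarrow> real ^ 'n) \<Rightarrow> bool" where
  "computed_by e p F \<longleftrightarrow>
     (\<forall>x. proc_defined_at e p x \<longrightarrow> F x = outputs e (proc_values e p x))"


section \<open>Piecewise linearization\<close>

text \<open>
  In the step functions below, \<open>v\<close> (or \<open>vc\<close>, \<open>vh\<close>) lists the values of the whole procedure at the
  reference point(s), and \<open>d\<close> the increments found so far.
\<close>

fun tangent_step :: "real list \<Rightarrow> real list \<Rightarrow> instr \<Rightarrow> real" where
  "tangent_step v d (Const c) = 0"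
| "tangent_step v d (Add j k) = d ! j + d ! k"
| "tangent_step v d (Sub j k) = d ! j - d ! k"
| "tangent_step v d (Mul j k) = v ! j * d ! k + d ! j * v ! k"
| "tangent_step v d (Elem D \<phi> j) = deriv \<phi> (v ! j) * d ! j"
| "tangent_step v d (Abs j) = \<bar>v ! j + d ! j\<bar> - \<bar>v ! j\<bar>"

definition tangent_increment ::
    "(nat \<Rightarrow> 'n::finite) \<Rightarrow> instr list \<Rightarrow> real ^ 'n \<Rightarrow> real ^ 'n \<Rightarrow> real ^ 'n" where
  "tangent_increment e p x0 dx =
     outputs e (run_procedure (tangent_step (proc_values e p x0)) p (inputs e dx))"

definition tangent_linearization ::
    "(nat \<Rightarrow> 'n::finite) \<Rightarrow> instr list \<Rightarrow> (real ^ 'n \<Rightarrow> real ^ 'n) \<Rightarrow>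
     real ^ 'n \<Rightarrow> real ^ 'n \<Rightarrow> real ^ 'n" where
  "tangent_linearization e p F x0 x = F x0 + tangent_increment e p x0 (x - x0)"

text \<open>
  In the last equation the subtracted term is the mean of the two values of the instruction itself,
  not the absolute value of the mean of its operand.
\<close>

fun secant_step :: "real list \<Rightarrow> real list \<Rightarrow> real list \<Rightarrow> instr \<Rightarrow> real" where
  "secant_step vc vh d (Const c) = 0"
| "secant_step vc vh d (Add j k) = d ! j + d ! k"
| "secant_step vc vh d (Sub j k) = d ! j - d ! k"
| "secant_step vc vh d (Mul j k) =
     (vc ! j + vh ! j) / 2 * d ! k + d ! j * ((vc ! k + vh ! k) / 2)"
| "secant_step vc vh d (Elem D \<phi> j) =
     (if vc ! j = vh ! j then deriv \<phi> ((vc ! j + vh ! j) / 2)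
      else (\<phi> (vh ! j) - \<phi> (vc ! j)) / (vh ! j - vc ! j)) * d ! j"
| "secant_step vc vh d (Abs j) =
     \<bar>(vc ! j + vh ! j) / 2 + d ! j\<bar> - (\<bar>vc ! j\<bar> + \<bar>vh ! j\<bar>) / 2"

definition secant_increment ::
    "(nat \<Rightarrow> 'n::finite) \<Rightarrow> instr list \<Rightarrow> real ^ 'n \<Rightarrow> real ^ 'n \<Rightarrow> real ^ 'n \<Rightarrow> real ^ 'n" where
  "secant_increment e p xc xh dx =
     outputs e (run_procedure (secant_step (proc_values e p xc) (proc_values e p xh)) p (inputs e dx))"

definition secant_linearization ::
    "(nat \<Rightarrow> 'n::finite) \<Rightarrow> instr list \<Rightarrow> (real ^ 'n \<Rightarrow> real ^ 'n) \<Rightarrow>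
     real ^ 'n \<Rightarrow> real ^ 'n \<Rightarrow> real ^ 'n \<Rightarrow> real ^ 'n" where
  "secant_linearization e p F xc xh x =
     midpoint (F xc) (F xh) + secant_increment e p xc xh (x - midpoint xc xh)"


section \<open>Piecewise linear functions and isolated roots\<close>

text \<open>A pair \<open>(A, b)\<close> stands for the affine function \<open>\<lambda>x. A *v x + b\<close>.\<close>

definition selection_functions ::
    "((real ^ 'n ^ 'n) \<times> (real ^ 'n)) set \<Rightarrow> (real ^ 'n \<Rightarrow> real ^ 'n) \<Rightarrow> bool" where
  "selection_functions S P \<longleftrightarrow>
     finite S \<and> continuous_on UNIV P \<and> (\<forall>x. \<exists>(A, b)\<in>S. P x = A *v x + b)"

definition active_on ::
    "(real ^ 'n) set \<Rightarrow> (real ^ 'n \<Rightarrow> real ^ 'n) \<Rightarrow> real ^ 'n ^ 'n \<Rightarrow> real ^ 'n \<Rightarrow> bool" where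
  "active_on V P A b \<longleftrightarrow> (\<forall>x\<in>V. P x = A *v x + b)"

text \<open>
  The choice of \<open>S\<close> is immaterial: an affine function active on a nonempty open set belongs to every
  family of selection functions of \<open>P\<close>.
\<close>

definition coherently_oriented_on ::
    "(real ^ 'n) set \<Rightarrow> (real ^ 'n \<Rightarrow> real ^ 'n) \<Rightarrow> bool" where
  "coherently_oriented_on U P \<longleftrightarrow>
     (\<exists>S. selection_functions S P \<and>
        (\<exists>s\<in>{-1, 1}. \<forall>(A, b)\<in>S. \<forall>V. open V \<and> V \<noteq> {} \<and> V \<subseteq> U \<and> active_on V P A b \<longrightarrow>
           sgn (det A) = s))"

definition isolated_root_in ::
    "(real ^ 'n \<Rightarrow> real ^ 'n) \<Rightarrow> (real ^ 'n) set \<Rightarrow> real ^ 'n \<Rightarrow> bool" where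
  "isolated_root_in F U x \<longleftrightarrow> x \<in> U \<and> F x = 0 \<and> (\<forall>y\<in>U. F y = 0 \<longrightarrow> y = x)"

end

theory Submission
  imports Defs "HOL-Library.Landau_Symbols"
begin

text \<open>
  The local Lipschitz continuity of the derivatives of the elemental functions gives
  \<open>norm (secant xc xh x - tangent x) \<le> C * (norm (xc - xs) + norm (xh - xs))\<close> uniformly for
  \<open>x\<close> in a bounded set. Coherent orientation makes the zeros of the tangent linearization in \<open>U\<close>
  isolated, so it is bounded away from zero on a small sphere around \<open>xs\<close>, and all preimages of a
  generic value near zero count with the same sign; hence its mapping degree on the ball does not
  vanish. The secant linearization itself need not be coherently oriented, because shifting the kinks
  can create new linear pieces, but its degree about every small value is the same by homotopy
  invariance, so that all these values are attained. The degree of a polynomial map \<open>g\<close> is measured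
  by the integral of \<open>bump (g x) * det (g' x)\<close>, whose integrand changes along a homotopy only by a
  divergence; continuous maps are reached by polynomial approximation.
\<close>

section \<open>The mapping degree as an integral\<close>

text \<open>The argument only asks whether a degree integral vanishes, so the bump is left
  unnormalised: the integral is nonzero for a polynomial close to the shifted tangent map, and it
  would be zero for a polynomial close to a map without zeros. The bump is the square of a positive
  part because it is differentiated once. The maps are differentiated twice, since the divergence
  identity rests on the symmetry of mixed second derivatives; this is why polynomials stand between
  the piecewise linear maps and the integral. The root \<open>xs\<close> may itself lie on a kink,
  where no single matrix describes the tangent map. The zeros are therefore counted for a nearby
  value \<open>P x0\<close> whose preimages all avoid the kinks. The parameter \<alpha> divides one
  margin \<open>m\<close>, a bound on how far a map may deviate from the tangent map and still reach
  a target: reference points within \<open>(1 - \<alpha>) * R\<close> use up at most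
  \<open>(1 - \<alpha>) * m\<close> of it and leave \<open>\<alpha> * m\<close> for the norm of the
  target.\<close>

lemma has_field_derivative_det_rows:
  fixes r :: "'n::finite \<Rightarrow> real \<Rightarrow> real ^ 'n"
  assumes "\<And>i. (r i has_vector_derivative r' i) (at s)"
  shows "((\<lambda>s. det (\<chi> i. r i s)) has_field_derivative
           (\<Sum>k\<in>UNIV. det (\<chi> i. if i = k then r' k else r i s))) (at s)"
proof -
  have comp: "((\<lambda>s. r i s $ j) has_field_derivative r' i $ j) (at s)" for i j
    using assms[of i] unfolding has_real_derivative_iff_has_vector_derivative
    by (rule bounded_linear.has_vector_derivative[OF bounded_linear_vec_nth])
  have *: "((\<lambda>s. \<Sum>p | p permutes UNIV. of_int (sign p) * (\<Prod>i\<in>UNIV. r i s $ p i)) has_field_derivative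
      (\<Sum>p | p permutes UNIV. of_int (sign p) * (\<Sum>k\<in>UNIV. r' k $ p k * (\<Prod>i\<in>UNIV - {k}. r i s $ p i)))) (at s)"
    by (intro DERIV_sum DERIV_cmult has_field_derivative_prod comp)
  have prod_eq: "(\<Prod>i\<in>UNIV. (if i = k then r' k else r i s) $ p i)
      = r' k $ p k * (\<Prod>i\<in>UNIV - {k}. r i s $ p i)" for p :: "'n \<Rightarrow> 'n" and k
    by (subst prod.remove[of _ k]) (auto intro!: prod.cong)
  have "(\<Sum>p | p permutes UNIV. of_int (sign p) * (\<Sum>k\<in>UNIV. r' k $ p k * (\<Prod>i\<in>UNIV - {k}. r i s $ p i)))
      = (\<Sum>k\<in>UNIV. det (\<chi> i. if i = k then r' k else r i s))"
    unfolding det_def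
    by (subst sum.swap) (simp add: prod_eq sum_distrib_left)
  then show ?thesis
    using * by (simp add: det_def)
qed

text \<open>
  If the rows are independent this is Cramer's rule for \<open>K\<close>. In general, compare the derivatives at
  \<open>s = 0\<close> of the two sides of \<open>det (A ** (1 + s v K\<^sup>T)) = det A * det (1 + s v K\<^sup>T)\<close>.
\<close>

lemma sum_inner_det_replace_row:
  fixes r :: "'n::finite \<Rightarrow> real ^ 'n" and v K :: "real ^ 'n"
  shows "(\<Sum>k\<in>UNIV. (v \<bullet> r k) * det (\<chi> i. if i = k then K else r i)) = (v \<bullet> K) * det (\<chi> i. r i)"
proof -
  define q where "q r i s = r i + s *\<^sub>R ((v \<bullet> r i) *\<^sub>R K)" for r :: "'n \<Rightarrow> real ^ 'n" and i s
  \<comment> \<open>With the unit vectors as rows, \<open>q e\<close> gives the rows of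
    \<open>1 + s v K^T\<close> itself.\<close>
  define e :: "'n \<Rightarrow> real ^ 'n" where "e i = axis i 1" for i
  have deriv: "((\<lambda>s. det (\<chi> i. q r i s)) has_field_derivative
      (\<Sum>k\<in>UNIV. (v \<bullet> r k) * det (\<chi> i. if i = k then K else r i))) (at 0)" for r
  proof -
    have "(q r i has_vector_derivative (v \<bullet> r i) *\<^sub>R K) (at 0)" for i
      unfolding q_def by (auto intro!: derivative_eq_intros)
    then have "((\<lambda>s. det (\<chi> i. q r i s)) has_field_derivative
      (\<Sum>k\<in>UNIV. det (\<chi> i. if i = k then (v \<bullet> r k) *\<^sub>R K else q r i 0))) (at 0)"
      by (rule has_field_derivative_det_rows)
    moreover have "det (\<chi> i. if i = k then (v \<bullet> r k) *\<^sub>R K else q r i 0)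
        = (v \<bullet> r k) * det (\<chi> i. if i = k then K else r i)" for k
      using det_row_mul[of k "v \<bullet> r k" "\<lambda>_. K" r]
      by (simp add: q_def scalar_mult_eq_scaleR cong: if_cong)
    ultimately show ?thesis by simp
  qed
  have v_e: "v \<bullet> e m = v $ m" for m
    by (simp add: e_def inner_axis)
  have "(\<chi> i. q r i s) = (\<chi> i. r i) ** (\<chi> i. q e i s)" for s
  proof -
    have *: "(\<Sum>m\<in>UNIV. r i $ m * q e m s $ j) = q r i s $ j" for i j
    proof -
      have "r i $ m * q e m s $ j = (if m = j then r i $ m else 0) + s * (v $ m * r i $ m) * K $ j" for m
        by (simp add: q_def v_e) (simp add: e_def axis_def algebra_simps)
      then have "(\<Sum>m\<in>UNIV. r i $ m * q e m s $ j)
          = (\<Sum>m\<in>UNIV. (if m = j then r i $ m else 0)) + (\<Sum>m\<in>UNIV. s * (v $ m * r i $ m) * K $ j)"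
        by (simp add: sum.distrib)
      also have "(\<Sum>m\<in>UNIV. s * (v $ m * r i $ m) * K $ j) = s * (v \<bullet> r i) * K $ j"
        by (simp add: inner_vec_def sum_distrib_left sum_distrib_right)
      finally show ?thesis
        by (simp add: q_def)
    qed
    then show ?thesis
      by (simp add: matrix_matrix_mult_def vec_eq_iff)
  qed
  then have prod: "det (\<chi> i. q r i s) = det (\<chi> i. r i) * det (\<chi> i. q e i s)" for s
    by (simp add: det_mul)
  have e_mat: "(\<chi> i. e i) = mat 1"
    by (simp add: e_def mat_def vec_eq_iff axis_def)
  \<comment> \<open>\<open>K\<close> is the combination of the unit rows with coefficients
    \<open>K $ i\<close>, so the row form of Cramer's rule extracts the coefficient of row
    \<open>k\<close>.\<close>
  have "det (\<chi> i. if i = k then K else e i) = K $ k" for k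
  proof -
    have "(\<Sum>i\<in>UNIV. K $ i *s row i (mat 1 :: real ^ 'n ^ 'n)) = K"
      by (simp add: vec_eq_iff row_def mat_def if_distrib cong: if_cong)
    moreover have "row i (mat 1 :: real ^ 'n ^ 'n) = e i" for i
      by (simp add: e_mat[symmetric] row_def)
    ultimately show ?thesis
      using cramer_lemma_transpose[of k K "mat 1"] by (simp cong: if_cong)
  qed
  then have e_sum: "(\<Sum>k\<in>UNIV. (v \<bullet> e k) * det (\<chi> i. if i = k then K else e i)) = v \<bullet> K"
    by (simp add: e_def inner_axis) (simp add: inner_vec_def)
  show ?thesis
    using DERIV_unique[OF deriv[of r]] DERIV_cmult[OF deriv[of e], of "det (\<chi> i. r i)"]
    by (simp add: prod e_sum mult.commute)
qed

text \<open>With \<open>K\<close> the derivative of a homotopy in its parameter and \<open>Z k j\<close> the mixed second derivatives.\<close>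

lemma sum_det_replace_two_rows:
  fixes r :: "'n::finite \<Rightarrow> real ^ 'n" and K :: "real ^ 'n" and Z :: "'n \<Rightarrow> 'n \<Rightarrow> real ^ 'n"
  assumes Z: "\<And>j k. Z j k = Z k j"
  shows "(\<Sum>j\<in>UNIV. \<Sum>k\<in>UNIV - {j}. det (\<chi> i. if i = k then Z j k else if i = j then K else r i)) = 0"
proof -
  \<comment> \<open>The value 0 on the diagonal completes the restricted sum to one over a full
    square array. Exchanging rows \<open>j\<close> and \<open>k\<close> changes the sign of an entry
    and, by the symmetry of \<open>Z\<close>, yields the mirrored entry, so the array cancels
    against its transpose.\<close>
  define d where "d j k = (if j = k then 0 else
      det (\<chi> i. if i = k then Z j k else if i = j then K else r i))" for j k
  have anti: "d j k = - d k j" for j k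
  proof (cases "j = k")
    case False
    let ?A = "\<chi> i. if i = k then Z j k else if i = j then K else r i"
    have "det (\<chi> i. ?A $ Transposition.transpose j k i) = of_int (sign (Transposition.transpose j k)) * det ?A"
      by (rule det_permute_rows) (simp add: permutes_swap_id)
    moreover have "(\<chi> i. ?A $ Transposition.transpose j k i) = (\<chi> i. if i = j then Z k j else if i = k then K else r i)"
      using False by (auto simp: vec_eq_iff Transposition.transpose_def Z[of j k])
    ultimately show ?thesis
      using False by (simp add: d_def sign_swap_id)
  qed (simp add: d_def)
  have "(\<Sum>j\<in>UNIV. \<Sum>k\<in>UNIV. d j k) = (\<Sum>j\<in>UNIV. \<Sum>k\<in>UNIV. d k j)"
    by (rule sum.swap)
  also have "\<dots> = - (\<Sum>j\<in>UNIV. \<Sum>k\<in>UNIV. d j k)"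
    by (subst anti) (simp add: sum_negf)
  finally have "(\<Sum>j\<in>UNIV. \<Sum>k\<in>UNIV. d j k) = 0" by simp
  moreover have "(\<Sum>k\<in>UNIV. d j k) = (\<Sum>k\<in>UNIV - {j}. det (\<chi> i. if i = k then Z j k else if i = j then K else r i))" for j
    by (rule sum.mono_neutral_cong_right) (auto simp: d_def)
  ultimately show ?thesis by simp
qed

section \<open>Partial derivatives of polynomials\<close>

text \<open>Symmetry of the second partials is carried through the induction; in the product case it
  is read off from the explicit product rule. That the partials are again polynomials later supplies
  their continuity.\<close>

lemma real_polynomial_function_partial_derivs:
  fixes f :: "real ^ 'n::finite \<Rightarrow> real"
  assumes "real_polynomial_function f"
  shows "\<exists>D D2. (\<forall>j. real_polynomial_function (D j)) \<and> (\<forall>j k. real_polynomial_function (D2 j k)) \<and>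
    (\<forall>j x. ((\<lambda>s. f (x + s *\<^sub>R axis j 1)) has_vector_derivative D j x) (at 0)) \<and>
    (\<forall>j k x. ((\<lambda>s. D k (x + s *\<^sub>R axis j 1)) has_vector_derivative D2 j k x) (at 0)) \<and>
    (\<forall>j k. D2 j k = D2 k j)"
  using assms
proof induction
  case (linear f)
  then interpret bounded_linear f .
  have "((\<lambda>s. f (x + s *\<^sub>R axis j 1)) has_vector_derivative f (axis j 1)) (at 0)" for j x
    by (auto simp: add scaleR intro!: derivative_eq_intros)
  then show ?case
    by (intro exI[of _ "\<lambda>j x. f (axis j 1)"] exI[of _ "\<lambda>j k x. 0"]) auto
next
  case (const c)
  show ?case
    by (intro exI[of _ "\<lambda>j x. 0"] exI[of _ "\<lambda>j k x. 0"]) auto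
next
  case (add f g)
  obtain D D2 where f: "\<And>j. real_polynomial_function (D j)" "\<And>j k. real_polynomial_function (D2 j k)"
    "\<And>j x. ((\<lambda>s. f (x + s *\<^sub>R axis j 1)) has_vector_derivative D j x) (at 0)"
    "\<And>j k x. ((\<lambda>s. D k (x + s *\<^sub>R axis j 1)) has_vector_derivative D2 j k x) (at 0)"
    "\<And>j k. D2 j k = D2 k j"
    using add.IH(1) by blast
  obtain E E2 where g: "\<And>j. real_polynomial_function (E j)" "\<And>j k. real_polynomial_function (E2 j k)"
    "\<And>j x. ((\<lambda>s. g (x + s *\<^sub>R axis j 1)) has_vector_derivative E j x) (at 0)"
    "\<And>j k x. ((\<lambda>s. E k (x + s *\<^sub>R axis j 1)) has_vector_derivative E2 j k x) (at 0)"
    "\<And>j k. E2 j k = E2 k j"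
    using add.IH(2) by blast
  show ?case
  proof (intro exI[of _ "\<lambda>j x. D j x + E j x"] exI[of _ "\<lambda>j k x. D2 j k x + E2 j k x"] conjI allI)
    show "(\<lambda>x. D2 j k x + E2 j k x) = (\<lambda>x. D2 k j x + E2 k j x)" for j k
      by (simp add: f(5)[of j k] g(5)[of j k])
  qed (intro real_polynomial_function.intros has_vector_derivative_add f g)+
next
  case (mult f g)
  obtain D D2 where f: "\<And>j. real_polynomial_function (D j)" "\<And>j k. real_polynomial_function (D2 j k)"
    "\<And>j x. ((\<lambda>s. f (x + s *\<^sub>R axis j 1)) has_vector_derivative D j x) (at 0)"
    "\<And>j k x. ((\<lambda>s. D k (x + s *\<^sub>R axis j 1)) has_vector_derivative D2 j k x) (at 0)"
    "\<And>j k. D2 j k = D2 k j"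
    using mult.IH(1) by blast
  obtain E E2 where g: "\<And>j. real_polynomial_function (E j)" "\<And>j k. real_polynomial_function (E2 j k)"
    "\<And>j x. ((\<lambda>s. g (x + s *\<^sub>R axis j 1)) has_vector_derivative E j x) (at 0)"
    "\<And>j k x. ((\<lambda>s. E k (x + s *\<^sub>R axis j 1)) has_vector_derivative E2 j k x) (at 0)"
    "\<And>j k. E2 j k = E2 k j"
    using mult.IH(2) by blast
  show ?case
  proof (intro exI[of _ "\<lambda>j x. f x * E j x + D j x * g x"]
      exI[of _ "\<lambda>j k x. (f x * E2 j k x + D j x * E k x) + (D k x * E j x + D2 j k x * g x)"] conjI allI)
    show "((\<lambda>s. f (x + s *\<^sub>R axis j 1) * g (x + s *\<^sub>R axis j 1)) has_vector_derivative
        f x * E j x + D j x * g x) (at 0)" for j x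
      using has_vector_derivative_mult[OF f(3) g(3), of x j] by simp
    show "((\<lambda>s. f (x + s *\<^sub>R axis j 1) * E k (x + s *\<^sub>R axis j 1) + D k (x + s *\<^sub>R axis j 1) * g (x + s *\<^sub>R axis j 1))
        has_vector_derivative (f x * E2 j k x + D j x * E k x) + (D k x * E j x + D2 j k x * g x)) (at 0)" for j k x
      using has_vector_derivative_add[OF has_vector_derivative_mult[OF f(3) g(4), of x j k]
          has_vector_derivative_mult[OF f(4) g(3), of k x j]] by simp
    show "(\<lambda>x. (f x * E2 j k x + D j x * E k x) + (D k x * E j x + D2 j k x * g x)) =
        (\<lambda>x. (f x * E2 k j x + D k x * E j x) + (D j x * E k x + D2 k j x * g x))" for j k
      by (simp add: f(5)[of j k] g(5)[of j k] algebra_simps fun_eq_iff)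
  qed (intro real_polynomial_function.intros mult.hyps f g)+
qed

lemma continuous_on_det_rows:
  fixes r :: "'n::finite \<Rightarrow> 'a::topological_space \<Rightarrow> real ^ 'n"
  assumes "\<And>i. continuous_on S (r i)"
  shows "continuous_on S (\<lambda>x. det (\<chi> i. r i x))"
  unfolding det_def using assms by simp (intro continuous_intros)

section \<open>A continuously differentiable bump\<close>

text \<open>Squaring removes the corner of the positive part: at 0 the difference quotient is
  bounded by \<open>\<bar>h\<bar>\<close>.\<close>

lemma has_field_derivative_max_0_power2:
  "((\<lambda>u::real. (max 0 u)\<^sup>2) has_field_derivative 2 * max 0 u) (at u)"
proof (cases u "0::real" rule: linorder_cases)
  case less
  then have "((\<lambda>u::real. 0) has_field_derivative 2 * max 0 u) (at u)" by simp
  then show ?thesis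
    by (rule has_field_derivative_transform_within_open[of _ _ _ "{..<0}"]) (use less in auto)
next
  case equal
  have "((\<lambda>h. (max 0 h)\<^sup>2 / h) \<longlongrightarrow> 0) (at (0::real))"
  proof (rule Lim_null_comparison)
    show "\<forall>\<^sub>F h in at (0::real). norm ((max 0 h)\<^sup>2 / h) \<le> \<bar>h\<bar>"
      by (intro always_eventually) (auto simp: max_def power2_eq_square)
    show "((\<lambda>h::real. \<bar>h\<bar>) \<longlongrightarrow> 0) (at 0)"
      by (rule tendsto_eq_intros refl)+ simp
  qed
  then show ?thesis
    using equal by (simp add: DERIV_def)
next
  case greater
  then have "((\<lambda>u::real. u\<^sup>2) has_field_derivative 2 * max 0 u) (at u)"
    by (auto intro!: derivative_eq_intros)
  then show ?thesis
    by (rule has_field_derivative_transform_within_open[of _ _ _ "{0<..}"]) (use greater in auto)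
qed

definition bump :: "real \<Rightarrow> 'a::real_inner \<Rightarrow> real" where
  "bump d y = (max 0 (d\<^sup>2 - y \<bullet> y))\<^sup>2"

definition bump_gradient :: "real \<Rightarrow> 'a::real_inner \<Rightarrow> 'a" where
  "bump_gradient d y = (- 4 * max 0 (d\<^sup>2 - y \<bullet> y)) *\<^sub>R y"

lemma has_field_derivative_bump:
  fixes f :: "real \<Rightarrow> 'a::real_inner"
  assumes "(f has_vector_derivative f') (at s)"
  shows "((\<lambda>s. bump d (f s)) has_field_derivative bump_gradient d (f s) \<bullet> f') (at s)"
proof -
  have "((\<lambda>s. d\<^sup>2 - f s \<bullet> f s) has_field_derivative - 2 * (f s \<bullet> f')) (at s)"
    using assms unfolding has_vector_derivative_def has_field_derivative_def
    by (auto intro!: derivative_eq_intros simp: inner_commute fun_eq_iff algebra_simps)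
  from DERIV_chain2[OF has_field_derivative_max_0_power2 this] show ?thesis
    by (simp add: bump_def bump_gradient_def algebra_simps)
qed

lemma bump_nonneg: "0 \<le> bump d y"
  by (simp add: bump_def)

lemma bump_pos: "norm y < d \<Longrightarrow> 0 < bump d y"
  using power_strict_mono[of "norm y" d 2] by (simp add: bump_def power2_norm_eq_inner[symmetric])

lemma
  assumes "0 \<le> d" "d \<le> norm y"
  shows bump_eq_0: "bump d y = 0" and bump_gradient_eq_0: "bump_gradient d y = 0"
proof -
  have "d\<^sup>2 \<le> y \<bullet> y"
    using assms by (simp add: power2_norm_eq_inner[symmetric] power_mono)
  then show "bump d y = 0" "bump_gradient d y = 0"
    by (simp_all add: bump_def bump_gradient_def)
qed

lemma continuous_on_bump:
  "continuous_on S f \<Longrightarrow> continuous_on S (\<lambda>x. bump d (f x))"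
  "continuous_on S f \<Longrightarrow> continuous_on S (\<lambda>x. bump_gradient d (f x))"
  unfolding bump_def bump_gradient_def by (intro continuous_intros; assumption)+

section \<open>Extension by zero and vanishing integrals of derivatives\<close>

text \<open>Differentiation under the integral takes place on a box and translation invariance lives
  on the whole space, so functions on the ball are extended by zero. The two closed pieces overlap
  in the sphere only, where both formulas give 0.\<close>

lemma continuous_on_zero_extension:
  fixes f :: "'b::topological_space \<Rightarrow> 'a::metric_space \<Rightarrow> 'c::real_normed_vector"
  assumes "closed X" "continuous_on (X \<times> cball c \<rho>) (\<lambda>(t, x). f t x)"
    and "\<And>t x. t \<in> X \<Longrightarrow> dist c x = \<rho> \<Longrightarrow> f t x = 0"
  shows "continuous_on (X \<times> UNIV) (\<lambda>(t, x). if x \<in> cball c \<rho> then f t x else 0)"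
proof -
  have "continuous_on (X \<times> cball c \<rho> \<union> X \<times> (- ball c \<rho>))
      (\<lambda>z. if snd z \<in> cball c \<rho> then f (fst z) (snd z) else 0)"
    by (rule continuous_on_cases)
      (use assms in \<open>auto intro!: closed_Times simp: not_less case_prod_unfold\<close>)
  moreover have "X \<times> cball c \<rho> \<union> X \<times> (- ball c \<rho>) = X \<times> UNIV"
    by auto
  ultimately show ?thesis
    by (simp add: case_prod_unfold)
qed

lemma continuous_on_zero_extension_UNIV:
  fixes f :: "'a::metric_space \<Rightarrow> 'c::real_normed_vector"
  assumes "continuous_on (cball c \<rho>) f" "\<And>x. dist c x = \<rho> \<Longrightarrow> f x = 0"
  shows "continuous_on UNIV (\<lambda>x. if x \<in> cball c \<rho> then f x else 0)"
proof -
  have "continuous_on (cball c \<rho> \<union> (- ball c \<rho>)) (\<lambda>x. if x \<in> cball c \<rho> then f x else 0)"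
    by (rule continuous_on_cases) (use assms in \<open>auto simp: not_less\<close>)
  moreover have "cball c \<rho> \<union> (- ball c \<rho>) = UNIV" by auto
  ultimately show ?thesis by simp
qed

text \<open>Off the sphere the extension is locally \<open>w\<close> or 0. On the sphere its
  difference quotient is dominated by that of \<open>w\<close>, which tends to 0 because
  \<open>w\<close> and \<open>w'\<close> both vanish there.\<close>

lemma has_field_derivative_zero_extension:
  fixes w :: "'a::real_normed_vector \<Rightarrow> real"
  assumes deriv: "((\<lambda>s. w (x + s *\<^sub>R e)) has_field_derivative w') (at 0)"
    and bd: "dist c x = \<rho> \<Longrightarrow> w x = 0 \<and> w' = 0"
  shows "((\<lambda>s. if x + s *\<^sub>R e \<in> cball c \<rho> then w (x + s *\<^sub>R e) else 0) has_field_derivative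
           (if x \<in> cball c \<rho> then w' else 0)) (at 0)"
proof -
  have open_vimage: "open {s. x + s *\<^sub>R e \<in> V}" if "open V" for V
    using open_vimage[OF that, of "\<lambda>s. x + s *\<^sub>R e"]
    by (simp add: vimage_def continuous_intros)
  consider "dist c x < \<rho>" | "dist c x = \<rho>" | "dist c x > \<rho>" by linarith
  then show ?thesis
  proof cases
    case 1
    show ?thesis
      by (rule has_field_derivative_transform_within_open[OF _ open_vimage[OF open_ball[of c \<rho>]]])
        (use deriv 1 in auto)
  next
    case 2
    have "((\<lambda>h. w (x + h *\<^sub>R e) / h) \<longlongrightarrow> 0) (at 0)"
      using deriv bd[OF 2] by (simp add: DERIV_def)
    then have "((\<lambda>h. (if x + h *\<^sub>R e \<in> cball c \<rho> then w (x + h *\<^sub>R e) else 0) / h) \<longlongrightarrow> 0) (at 0)"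
      by (rule Lim_null_comparison[rotated, OF tendsto_norm_zero])
        (intro always_eventually, auto)
    then show ?thesis
      using bd[OF 2] 2 by (simp add: DERIV_def cong: if_cong)
  next
    case 3
    have "open (- cball c \<rho>)" by (rule open_Compl[OF closed_cball])
    from open_vimage[OF this] show ?thesis
      by (rule has_field_derivative_transform_within_open[where f="\<lambda>_. 0", rotated])
        (use 3 in auto)
  qed
qed

text \<open>Translation invariance makes the integrals of all difference quotients of \<open>w\<close> vanish.\<close>

lemma has_integral_directional_derivative_0:
  fixes w w' :: "'a::euclidean_space \<Rightarrow> real"
  assumes cont: "continuous_on UNIV w" "continuous_on UNIV w'"
    and deriv: "\<And>x. ((\<lambda>s. w (x + s *\<^sub>R e)) has_field_derivative w' x) (at 0)"
    and supp: "\<And>x. x \<notin> cball c \<rho> \<Longrightarrow> w x = 0" "\<And>x. x \<notin> cball c \<rho> \<Longrightarrow> w' x = 0"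
  shows "(w' has_integral 0) UNIV"
proof -
  have integrable: "integrable lborel f"
    if "continuous_on UNIV f" "\<And>x. x \<notin> cball c \<rho> \<Longrightarrow> f x = 0" for f :: "'a \<Rightarrow> real"
  proof -
    have "integrable lborel (\<lambda>x. indicator (cball c \<rho>) x *\<^sub>R f x)"
      by (rule borel_integrable_compact) (use that in \<open>auto intro: continuous_on_subset\<close>)
    also have "(\<lambda>x. indicator (cball c \<rho>) x *\<^sub>R f x) = f"
      using that by (auto simp: indicator_def fun_eq_iff)
    finally show ?thesis .
  qed
  have "bounded (w' ` cball c \<rho>)"
    by (intro compact_imp_bounded compact_continuous_image continuous_on_subset[OF cont(2)]) auto
  then obtain C0 where "\<And>x. x \<in> cball c \<rho> \<Longrightarrow> \<bar>w' x\<bar> \<le> C0"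
    unfolding bounded_iff by fastforce
  then have C: "\<bar>w' x\<bar> \<le> max 0 C0" for x
    using supp(2)[of x] by (cases "x \<in> cball c \<rho>") (fastforce simp: max_def)+
  define C where "C = max 0 C0"
  have deriv_at: "((\<lambda>s. w (x + s *\<^sub>R e)) has_field_derivative w' (x + s *\<^sub>R e)) (at s)" for x s
    using deriv[of "x + s *\<^sub>R e"] DERIV_at_within_shift[of "\<lambda>s. w (x + s *\<^sub>R e)" "w' (x + s *\<^sub>R e)" s 0 UNIV]
    by (simp add: algebra_simps)
  \<comment> \<open>The mean value estimate along the line makes \<open>C\<close> a common bound for
    all difference quotients, as dominated convergence requires.\<close>
  have lip: "\<bar>w (x + h *\<^sub>R e) - w x\<bar> \<le> C * \<bar>h\<bar>" for x h
    using field_differentiable_bound[of UNIV "\<lambda>s. w (x + s *\<^sub>R e)" "\<lambda>s. w' (x + s *\<^sub>R e)" C h 0]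
      deriv_at C by (simp add: C_def)
  define q where "q m x = (w (x + inverse (Suc m) *\<^sub>R e) - w x) / inverse (Suc m)" for m x
  have shift: "integrable lborel (\<lambda>x. w (x + a))" "(\<integral>x. w (x + a) \<partial>lborel) = (\<integral>x. w x \<partial>lborel)" for a
  proof -
    have *: "integrable (distr lborel borel ((+) a)) w"
      unfolding lborel_distr_plus by (rule integrable[OF cont(1) supp(1)])
    have meas: "(+) a \<in> measurable lborel borel" "w \<in> borel_measurable borel"
      by (auto intro: borel_measurable_continuous_onI cont)
    show "integrable lborel (\<lambda>x. w (x + a))"
      using integrable_distr[OF meas(1) *] by (simp add: add.commute)
    show "(\<integral>x. w (x + a) \<partial>lborel) = (\<integral>x. w x \<partial>lborel)"
      using integral_distr[OF meas] by (simp add: lborel_distr_plus add.commute)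
  qed
  have q0: "integral\<^sup>L lborel (q m) = 0" for m
    unfolding q_def using shift integrable[OF cont(1) supp(1)]
    by simp
  \<comment> \<open>All steps are at most 1, so every quotient is supported in the ball enlarged by
    \<open>norm e\<close>; the constant \<open>C\<close> on that ball is the dominating
    function.\<close>
  have "(\<lambda>m. integral\<^sup>L lborel (q m)) \<longlonglongrightarrow> integral\<^sup>L lborel w'"
  proof (rule integral_dominated_convergence[where w = "\<lambda>x. indicator (cball c (\<rho> + norm e)) x *\<^sub>R C"])
    show "w' \<in> borel_measurable lborel" "q m \<in> borel_measurable lborel" for m
      unfolding q_def using cont
      by (auto intro!: borel_measurable_continuous_onI continuous_intros continuous_on_compose2[OF cont(1)])
    show "integrable lborel (\<lambda>x. indicator (cball c (\<rho> + norm e)) x *\<^sub>R C)"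
      by (rule borel_integrable_compact) auto
    show "AE x in lborel. (\<lambda>m. q m x) \<longlonglongrightarrow> w' x"
    proof (intro AE_I2)
      fix x
      have "((\<lambda>h. (w (x + h *\<^sub>R e) - w x) / h) \<longlongrightarrow> w' x) (at 0)"
        using deriv[of x] by (simp add: DERIV_def)
      moreover have "filterlim (\<lambda>m. inverse (real (Suc m))) (at 0) sequentially"
        by (rule filterlim_atI[OF LIMSEQ_inverse_real_of_nat]) auto
      ultimately show "(\<lambda>m. q m x) \<longlonglongrightarrow> w' x"
        unfolding q_def by (rule filterlim_compose)
    qed
    show "AE x in lborel. norm (q m x) \<le> indicator (cball c (\<rho> + norm e)) x *\<^sub>R C" for m
    proof (intro AE_I2)
      fix x
      let ?h = "inverse (real (Suc m))"
      have "\<bar>w (x + ?h *\<^sub>R e) - w x\<bar> \<le> C * ?h"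
        using lip[of x ?h] by simp
      then have 1: "\<bar>q m x\<bar> \<le> C"
        unfolding q_def abs_divide by (simp add: field_simps)
      have 2: "q m x = 0" if "x \<notin> cball c (\<rho> + norm e)"
      proof -
        have "?h * norm e \<le> 1 * norm e"
          by (intro mult_right_mono) (auto simp: inverse_le_1_iff)
        then have "dist x (x + ?h *\<^sub>R e) \<le> norm e"
          by (simp add: dist_norm)
        moreover have "dist c x \<le> dist c (x + ?h *\<^sub>R e) + dist x (x + ?h *\<^sub>R e)"
          by (metis dist_commute dist_triangle)
        ultimately have "x + ?h *\<^sub>R e \<notin> cball c \<rho>"
          using that by (simp del: dist_add_cancel)
        moreover have "x \<notin> cball c \<rho>"
          using that norm_ge_zero[of e] by (simp add: mem_cball del: norm_ge_zero)
        ultimately show ?thesis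
          by (simp add: q_def supp(1) del: of_nat_Suc)
      qed
      show "norm (q m x) \<le> indicator (cball c (\<rho> + norm e)) x *\<^sub>R C"
        using 1 2 by (cases "x \<in> cball c (\<rho> + norm e)") auto
    qed
  qed
  then have "integral\<^sup>L lborel w' = 0"
    by (simp add: q0 LIMSEQ_const_iff)
  then show ?thesis
    using has_integral_integral_lborel[OF integrable[OF cont(2) supp(2)]] by simp
qed

section \<open>Homotopy invariance of the degree integral\<close>

text \<open>Only one-variable derivatives along the axes are recorded; with continuity and symmetry
  they carry the whole divergence argument.\<close>

definition has_partials ::
    "(real ^ 'n \<Rightarrow> real ^ 'n) \<Rightarrow> ('n::finite \<Rightarrow> real ^ 'n \<Rightarrow> real ^ 'n) \<Rightarrow>
     ('n \<Rightarrow> 'n \<Rightarrow> real ^ 'n \<Rightarrow> real ^ 'n) \<Rightarrow> bool" where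
  "has_partials g D D2 \<longleftrightarrow>
     continuous_on UNIV g \<and> (\<forall>j. continuous_on UNIV (D j)) \<and> (\<forall>j k. continuous_on UNIV (D2 j k)) \<and>
     (\<forall>j x. ((\<lambda>s. g (x + s *\<^sub>R axis j 1)) has_vector_derivative D j x) (at 0)) \<and>
     (\<forall>j k x. ((\<lambda>s. D k (x + s *\<^sub>R axis j 1)) has_vector_derivative D2 j k x) (at 0)) \<and>
     (\<forall>j k. D2 j k = D2 k j)"

text \<open>Row \<open>j\<close> is the partial derivative in direction \<open>j\<close>, so the
  matrix is the transposed Jacobian, with the same determinant. If \<open>norm (g x)\<close> is at
  least \<open>d > 0\<close> on the boundary of a ball \<open>S\<close>, this is the analytic degree
  about 0 times a factor depending on \<open>d\<close> and the dimension.\<close>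

definition degree_integral ::
    "(real ^ 'n) set \<Rightarrow> real \<Rightarrow> (real ^ 'n \<Rightarrow> real ^ 'n) \<Rightarrow>
     ('n::finite \<Rightarrow> real ^ 'n \<Rightarrow> real ^ 'n) \<Rightarrow> real" where
  "degree_integral S d g D = integral S (\<lambda>x. bump d (g x) * det (\<chi> j. D j x))"

lemma polynomial_function_has_partials:
  fixes g :: "real ^ 'n::finite \<Rightarrow> real ^ 'n"
  assumes "polynomial_function g"
  obtains D D2 where "has_partials g D D2"
proof -
  have *: "real_polynomial_function (\<lambda>x. g x $ i)" for i
    using assms bounded_linear_vec_nth unfolding polynomial_function_def o_def by blast
  define P where "P i D D2 \<longleftrightarrow> (\<forall>j. real_polynomial_function (D j)) \<and> (\<forall>j k. real_polynomial_function (D2 j k)) \<and>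
    (\<forall>j x. ((\<lambda>s. g (x + s *\<^sub>R axis j 1) $ i) has_vector_derivative D j x) (at 0)) \<and>
    (\<forall>j k x. ((\<lambda>s. D k (x + s *\<^sub>R axis j 1)) has_vector_derivative D2 j k x) (at 0)) \<and>
    (\<forall>j k. D2 j k = D2 k j)" for i D D2
  have "\<exists>D D2. P i D D2" for i
    unfolding P_def by (rule real_polynomial_function_partial_derivs[OF *])
  then obtain D D2 where P: "\<And>i. P i (D i) (D2 i)" by metis
  have D: "real_polynomial_function (D i j)" "real_polynomial_function (D2 i j k)"
    "((\<lambda>s. g (x + s *\<^sub>R axis j 1) $ i) has_vector_derivative D i j x) (at 0)"
    "((\<lambda>s. D i k (x + s *\<^sub>R axis j 1)) has_vector_derivative D2 i j k x) (at 0)"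
    "D2 i j k = D2 i k j" for i j k x
    using P[of i] unfolding P_def by blast+
  have cont: "continuous_on UNIV f" if "real_polynomial_function f" for f :: "real ^ 'n \<Rightarrow> real"
    using that by (simp add: real_polynomial_function_eq continuous_on_polymonial_function)
  have vec: "((\<lambda>s. \<chi> i. f i s) has_vector_derivative (\<chi> i. f' i)) (at 0)"
    if "\<And>i. (f i has_vector_derivative f' i) (at 0)" for f :: "'n \<Rightarrow> real \<Rightarrow> real" and f'
    using that unfolding has_vector_derivative_def
    by (subst has_derivative_componentwise_within) (auto simp: Basis_vec_def inner_axis)
  have "has_partials g (\<lambda>j x. \<chi> i. D i j x) (\<lambda>j k x. \<chi> i. D2 i j k x)"
    unfolding has_partials_def
  proof (intro conjI allI)
    show "continuous_on UNIV g"
      using assms by (rule continuous_on_polymonial_function)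
    show "continuous_on UNIV (\<lambda>x. \<chi> i. D i j x)" "continuous_on UNIV (\<lambda>x. \<chi> i. D2 i j k x)" for j k
      by (intro continuous_on_vec_lambda cont D)+
    show "((\<lambda>s. g (x + s *\<^sub>R axis j 1)) has_vector_derivative (\<chi> i. D i j x)) (at 0)" for j x
      using vec[of "\<lambda>i s. g (x + s *\<^sub>R axis j 1) $ i", OF D(3)] by simp
    show "((\<lambda>s. \<chi> i. D i k (x + s *\<^sub>R axis j 1)) has_vector_derivative (\<chi> i. D2 i j k x)) (at 0)" for j k x
      by (intro vec D)
    show "(\<lambda>x. \<chi> i. D2 i j k x) = (\<lambda>x. \<chi> i. D2 i k j x)" for j k
      by (simp add: D(5)[of _ j k])
  qed
  then show thesis by (rule that)
qed

text \<open>Along the straight homotopy \<open>H\<close>, the \<open>t\<close>-derivative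
  \<open>a'\<close> of the integrand \<open>a\<close> is the divergence of the field with components
  \<open>w t j\<close>, the integrand with row \<open>j\<close> replaced by the velocity
  \<open>K\<close> of the homotopy. The bound \<open>d\<close> on the sphere makes this field and
  its derivatives vanish there, so the divergence integrates to 0.\<close>

theorem degree_integral_homotopy:
  fixes g0 g1 :: "real ^ 'n::finite \<Rightarrow> real ^ 'n"
  assumes p0: "has_partials g0 D0 E0" and p1: "has_partials g1 D1 E1"
    and d: "0 \<le> d"
    and bd: "\<And>t x. 0 \<le> t \<Longrightarrow> t \<le> 1 \<Longrightarrow> dist c x = \<rho> \<Longrightarrow> d \<le> norm (g0 x + t *\<^sub>R (g1 x - g0 x))"
  shows "degree_integral (cball c \<rho>) d g0 D0 = degree_integral (cball c \<rho>) d g1 D1"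
proof -
  define K where "K x = g1 x - g0 x" for x
  define DK where "DK j x = D1 j x - D0 j x" for j x
  define H where "H t x = g0 x + t *\<^sub>R K x" for t x
  define r where "r t j x = D0 j x + t *\<^sub>R DK j x" for t j x
  define Z where "Z t j k x = E0 j k x + t *\<^sub>R (E1 j k x - E0 j k x)" for t j k x
  define a where "a t x = bump d (H t x) * det (\<chi> i. r t i x)" for t x
  define a' where "a' t x = (bump_gradient d (H t x) \<bullet> K x) * det (\<chi> i. r t i x)
    + bump d (H t x) * (\<Sum>k\<in>UNIV. det (\<chi> i. if i = k then DK k x else r t i x))" for t x
  define w where "w t j x = bump d (H t x) * det (\<chi> i. if i = j then K x else r t i x)" for t j x
  \<comment> \<open>In row \<open>j\<close> it is \<open>K\<close> that is differentiated, which
    gives \<open>DK j\<close>; any other row \<open>k\<close> contributes the mixed partial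
    \<open>Z t j k\<close>.\<close>
  define w' where "w' t j x = (bump_gradient d (H t x) \<bullet> r t j x) * det (\<chi> i. if i = j then K x else r t i x)
    + bump d (H t x) * (\<Sum>k\<in>UNIV. det (\<chi> i. if i = k then (if k = j then DK j x else Z t j k x)
        else if i = j then K x else r t i x))" for t j x

  have cont0: "continuous_on UNIV g0" "continuous_on UNIV (D0 j)" "continuous_on UNIV (E0 j k)"
    "continuous_on UNIV g1" "continuous_on UNIV (D1 j)" "continuous_on UNIV (E1 j k)" for j k
    using p0 p1 by (auto simp: has_partials_def)
  note cont1 = continuous_on_compose2[OF cont0(1)] continuous_on_compose2[OF cont0(2)]
    continuous_on_compose2[OF cont0(3)] continuous_on_compose2[OF cont0(4)]
    continuous_on_compose2[OF cont0(5)] continuous_on_compose2[OF cont0(6)]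
  have cont: "continuous_on S f \<Longrightarrow> continuous_on S (\<lambda>z. K (f z))"
    "continuous_on S f \<Longrightarrow> continuous_on S (\<lambda>z. DK j (f z))"
    "continuous_on S h \<Longrightarrow> continuous_on S f \<Longrightarrow> continuous_on S (\<lambda>z. H (h z) (f z))"
    "continuous_on S h \<Longrightarrow> continuous_on S f \<Longrightarrow> continuous_on S (\<lambda>z. r (h z) j (f z))"
    "continuous_on S h \<Longrightarrow> continuous_on S f \<Longrightarrow> continuous_on S (\<lambda>z. Z (h z) j k (f z))"
    for S :: "'z::topological_space set" and f h j k
    unfolding K_def DK_def H_def r_def Z_def by (auto intro!: continuous_intros cont1)
  have cont_if: "continuous_on S (\<lambda>x. if P then f x else h x)"
    if "continuous_on S f" "continuous_on S h" for P and S :: "'z::topological_space set" and f h :: "'z \<Rightarrow> real ^ 'n"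
    using that by (cases P) auto
  have cont_a': "continuous_on S (\<lambda>(t, x). a' t x)" for S
    unfolding a'_def case_prod_unfold
    by (intro continuous_intros continuous_on_bump continuous_on_det_rows cont cont_if)
  have cont_a: "continuous_on S (a t)" for S t
    unfolding a_def by (intro continuous_intros continuous_on_bump continuous_on_det_rows cont)
  have cont_w: "continuous_on S (w t j)" for S t j
    unfolding w_def
    by (intro continuous_intros continuous_on_bump continuous_on_det_rows cont cont_if)
  have cont_w': "continuous_on S (w' t j)" for S t j
    unfolding w'_def
    by (intro continuous_intros continuous_on_bump continuous_on_det_rows cont cont_if)

  have dK: "((\<lambda>s. K (x + s *\<^sub>R axis j 1)) has_vector_derivative DK j x) (at 0)" for x j
    using p0 p1 unfolding K_def DK_def has_partials_def by (intro has_vector_derivative_diff) auto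
  have dH: "((\<lambda>s. H t (x + s *\<^sub>R axis j 1)) has_vector_derivative r t j x) (at 0)" for x j t
    using p0 dK[of x j] unfolding H_def r_def has_partials_def
    by (intro has_vector_derivative_add has_vector_derivative_scaleR[where f="\<lambda>_. t" and f'=0, simplified]) auto
  have dDK: "((\<lambda>s. DK k (x + s *\<^sub>R axis j 1)) has_vector_derivative (E1 j k x - E0 j k x)) (at 0)" for x j k
    using p0 p1 unfolding DK_def has_partials_def by (intro has_vector_derivative_diff) auto
  have dr: "((\<lambda>s. r t k (x + s *\<^sub>R axis j 1)) has_vector_derivative Z t j k x) (at 0)" for x j k t
    using p0 dDK[of k x j] unfolding r_def Z_def has_partials_def
    by (intro has_vector_derivative_add has_vector_derivative_scaleR[where f="\<lambda>_. t" and f'=0, simplified]) auto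
  have Z_sym: "Z t j k x = Z t k j x" for t j k x
  proof -
    have "E0 j k = E0 k j" "E1 j k = E1 k j" using p0 p1 unfolding has_partials_def by blast+
    then show ?thesis by (simp add: Z_def)
  qed

  have dw: "((\<lambda>s. w t j (x + s *\<^sub>R axis j 1)) has_field_derivative w' t j x) (at 0)" for t j x
  proof -
    have rows: "((\<lambda>s. if i = j then K (x + s *\<^sub>R axis j 1) else r t i (x + s *\<^sub>R axis j 1))
        has_vector_derivative (if i = j then DK j x else Z t j i x)) (at 0)" for i
      using dK dr by auto
    have "((\<lambda>s. det (\<chi> i. if i = j then K (x + s *\<^sub>R axis j 1) else r t i (x + s *\<^sub>R axis j 1)))
        has_field_derivative (\<Sum>k\<in>UNIV. det (\<chi> i. if i = k then (if k = j then DK j x else Z t j k x)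
        else if i = j then K x else r t i x))) (at 0)"
      using has_field_derivative_det_rows[OF rows, of "\<lambda>i. i"] by (simp cong: if_cong)
    from DERIV_mult[OF has_field_derivative_bump[OF dH, of d t x j] this] show ?thesis
      by (simp add: w_def w'_def algebra_simps cong: if_cong)
  qed
  have da: "((\<lambda>t. a t x) has_field_derivative a' t x) (at t)" for t x
  proof -
    have rows: "((\<lambda>t. r t i x) has_vector_derivative DK i x) (at t)" for i
      unfolding r_def by (auto intro!: derivative_eq_intros)
    have Hd: "((\<lambda>t. H t x) has_vector_derivative K x) (at t)"
      unfolding H_def by (auto intro!: derivative_eq_intros)
    from DERIV_mult[OF has_field_derivative_bump[OF Hd] has_field_derivative_det_rows[OF rows, of "\<lambda>i. i"]]
    show ?thesis
      by (simp add: a_def a'_def algebra_simps)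
  qed

  \<comment> \<open>The terms with the bump gradient combine by the Cramer identity into the
    gradient along \<open>K\<close>. The terms with \<open>k = j\<close> form the
    \<open>t\<close>-derivative of the Jacobian determinant, and those with
    \<open>k \<noteq> j\<close> cancel by the symmetry of \<open>Z\<close>.\<close>
  have div: "(\<Sum>j\<in>UNIV. w' t j x) = a' t x" for t x
  proof -
    let ?d = "\<lambda>j k. det (\<chi> i. if i = k then Z t j k x else if i = j then K x else r t i x)"
    have "(\<Sum>k\<in>UNIV. det (\<chi> i. if i = k then (if k = j then DK j x else Z t j k x)
        else if i = j then K x else r t i x))
      = det (\<chi> i. if i = j then DK j x else r t i x) + (\<Sum>k\<in>UNIV - {j}. ?d j k)" for j
      by (subst sum.remove[of _ j])
        (auto intro!: arg_cong2[where f="(+)"] sum.cong arg_cong[where f=det] simp: vec_eq_iff split: if_split_asm)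
    then have "(\<Sum>j\<in>UNIV. w' t j x)
      = (\<Sum>j\<in>UNIV. (bump_gradient d (H t x) \<bullet> r t j x) * det (\<chi> i. if i = j then K x else r t i x))
        + bump d (H t x) * ((\<Sum>j\<in>UNIV. det (\<chi> i. if i = j then DK j x else r t i x))
           + (\<Sum>j\<in>UNIV. \<Sum>k\<in>UNIV - {j}. ?d j k))"
      by (simp add: w'_def sum.distrib sum_distrib_left algebra_simps)
    also have "(\<Sum>j\<in>UNIV. \<Sum>k\<in>UNIV - {j}. ?d j k) = 0"
      by (rule sum_det_replace_two_rows) (rule Z_sym)
    finally show ?thesis
      by (simp add: sum_inner_det_replace_row a'_def)
  qed

  have vanish: "bump d (H t x) = 0" "bump_gradient d (H t x) = 0"
    if "t \<in> {0..1}" "dist c x = \<rho>" for t x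
    using bd[of t x] that d by (auto simp: H_def K_def bump_eq_0 bump_gradient_eq_0)

  define ext where "ext f x = (if x \<in> cball c \<rho> then f x else 0 :: real)" for f x
  have int_w': "(ext (w' t j) has_integral 0) UNIV" if t: "t \<in> {0..1}" for t j
  proof (rule has_integral_directional_derivative_0)
    show "continuous_on UNIV (ext (w t j))" "continuous_on UNIV (ext (w' t j))"
      unfolding ext_def using vanish[OF t]
      by (intro continuous_on_zero_extension_UNIV cont_w cont_w'; simp add: w_def w'_def)+
    show "((\<lambda>s. ext (w t j) (x + s *\<^sub>R axis j 1)) has_field_derivative ext (w' t j) x) (at 0)" for x
      unfolding ext_def using vanish[OF t]
      by (intro has_field_derivative_zero_extension dw) (auto simp: w_def w'_def)
  qed (auto simp: ext_def)
  have int_a': "(ext (a' t) has_integral 0) UNIV" if t: "t \<in> {0..1}" for t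
  proof -
    have "((\<lambda>x. \<Sum>j\<in>UNIV. ext (w' t j) x) has_integral (\<Sum>j\<in>(UNIV::'n set). 0)) UNIV"
      by (intro has_integral_sum int_w'[OF t]) auto
    also have "(\<lambda>x. \<Sum>j\<in>UNIV. ext (w' t j) x) = ext (a' t)"
      by (auto simp: ext_def div)
    finally show ?thesis by simp
  qed

  obtain u v where box: "cball c \<rho> \<subseteq> cbox u v"
    using bounded_subset_cbox_symmetric[OF bounded_cball] by metis
  have restrict: "integral (cbox u v) (ext f) = integral (cball c \<rho>) f" for f
  proof -
    have "integral (cbox u v) (ext f) = integral (cbox u v) (\<lambda>x. if x \<in> cball c \<rho> then f x else 0)"
      unfolding ext_def ..
    also have "\<dots> = integral (cbox u v \<inter> cball c \<rho>) f"
      by (simp only: Int_commute integral_restrict_Int)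
    also have "cbox u v \<inter> cball c \<rho> = cball c \<rho>" using box by blast
    finally show ?thesis .
  qed
  have int_a'_box: "integral (cbox u v) (ext (a' t)) = 0" if t: "t \<in> {0..1}" for t
  proof -
    have "integral (cbox u v) (ext (a' t)) = integral (cball c \<rho>) (a' t)"
      by (rule restrict)
    also have "\<dots> = integral UNIV (ext (a' t))"
      unfolding ext_def by (rule integral_restrict_UNIV[symmetric])
    also have "\<dots> = 0"
      using int_a'[OF t] by (rule integral_unique)
    finally show ?thesis .
  qed
  have leibniz: "((\<lambda>t. integral (cbox u v) (ext (a t))) has_field_derivative 0) (at t within {0..1})"
    if t: "t \<in> {0..1}" for t
  proof -
    have "((\<lambda>t. integral (cbox u v) (ext (a t))) has_field_derivative integral (cbox u v) (ext (a' t)))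
        (at t within {0..1})"
    proof (rule leibniz_rule_field_derivative)
      show "((\<lambda>t. ext (a t) x) has_field_derivative ext (a' t) x) (at t within {0..1})" for t x
        using da[of x t] by (auto simp: ext_def intro: has_field_derivative_at_within)
      show "ext (a t) integrable_on cbox u v" if "t \<in> {0..1}" for t
      proof -
        have "continuous_on UNIV (ext (a t))"
          unfolding ext_def using vanish[OF that]
          by (intro continuous_on_zero_extension_UNIV cont_a) (auto simp: a_def)
        then show ?thesis
          by (intro integrable_continuous) (rule continuous_on_subset, auto)
      qed
      have "continuous_on ({0..1} \<times> UNIV) (\<lambda>(t, x). if x \<in> cball c \<rho> then a' t x else 0)"
        using vanish by (intro continuous_on_zero_extension cont_a') (auto simp: a'_def)
      then show "continuous_on ({0..1} \<times> cbox u v) (\<lambda>(t, x). ext (a' t) x)"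
        unfolding ext_def by (rule continuous_on_subset) auto
    qed (use t in auto)
    then show ?thesis by (simp add: int_a'_box[OF t])
  qed
  have "integral (cbox u v) (ext (a 0)) = integral (cbox u v) (ext (a 1))"
    using has_field_derivative_zero_constant[of "{0..1}" "\<lambda>t. integral (cbox u v) (ext (a t))"] leibniz
    by (metis atLeastAtMost_iff convex_real_interval(5) order_refl zero_le_one)
  then show ?thesis
    by (simp add: restrict degree_integral_def a_def[abs_def] H_def r_def K_def DK_def)
qed

section \<open>From local signs to the existence of zeros\<close>

lemma continuous_on_compact_pos_lower_bound:
  fixes h :: "'a::topological_space \<Rightarrow> real"
  assumes "compact S" "continuous_on S h" "\<And>x. x \<in> S \<Longrightarrow> 0 < h x"
  obtains d where "0 < d" "\<And>x. x \<in> S \<Longrightarrow> d \<le> h x"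
proof (cases "S = {}")
  case False
  then obtain y where "y \<in> S" "\<And>x. x \<in> S \<Longrightarrow> h y \<le> h x"
    using continuous_attains_inf[OF assms(1) _ assms(2)] by blast
  then show thesis using assms(3) that by blast
qed (use that[of 1] in auto)

lemma integrable_on_compact:
  fixes f :: "'a::euclidean_space \<Rightarrow> real"
  assumes "compact S" "continuous_on S f"
  shows "f integrable_on S"
  using borel_integrable_compact[OF assms]
  by (intro set_borel_integral_eq_integral(1)) (simp add: set_integrable_def)

lemma continuous_on_matrix_vector_mult:
  fixes A :: "real ^ 'n ^ 'm"
  shows "continuous_on S f \<Longrightarrow> continuous_on S (\<lambda>x. A *v f x)"
  by (rule continuous_on_compose2[OF matrix_vector_mult_linear_continuous_on[of UNIV]]) auto

text \<open>A continuous nonnegative function with integral 0 over a box vanishes on it, so a small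
  box around the centre already carries a positive amount.\<close>

lemma integral_pos_cball:
  fixes f :: "'a::euclidean_space \<Rightarrow> real"
  assumes cont: "continuous_on (cball x r) f" and r: "0 < r"
    and nonneg: "\<And>y. 0 \<le> f y" and pos: "0 < f x"
  shows "0 < integral (cball x r) f"
proof -
  obtain a b where ab: "x \<in> box a b" "cbox a b \<subseteq> cball x r"
    using r open_contains_cbox[of "ball x r" x] by (metis ball_subset_cball centre_in_ball open_ball order_trans)
  have int: "f integrable_on cball x r" "f integrable_on cbox a b"
    using cont ab by (auto intro!: integrable_on_compact intro: continuous_on_subset)
  have "integral (cbox a b) f \<noteq> 0"
  proof
    assume "integral (cbox a b) f = 0"
    then have "(f has_integral 0) (cbox a b)"
      using int(2) by (simp add: has_integral_integral)
    then have "f x = 0"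
      using ab box_subset_cbox[of a b]
      by (intro has_integral_0_cbox_imp_0[of a b f]) (auto intro: continuous_on_subset[OF cont] nonneg)
    then show False using pos by simp
  qed
  moreover have "0 \<le> integral (cbox a b) f"
    using nonneg by (intro integral_nonneg int) auto
  moreover have "integral (cbox a b) f \<le> integral (cball x r) f"
    using nonneg int ab by (intro integral_subset_le) auto
  ultimately show ?thesis by linarith
qed

lemma has_partials_linear:
  fixes A :: "real ^ 'n::finite ^ 'n"
  shows "has_partials (\<lambda>y. A *v (y - x)) (\<lambda>j y. A *v axis j 1) (\<lambda>j k y. 0)"
proof -
  have "((\<lambda>s. A *v (y + s *\<^sub>R axis j 1 - x)) has_vector_derivative A *v axis j 1) (at 0)" for j y
  proof -
    have "(\<lambda>s. A *v (y + s *\<^sub>R axis j 1 - x)) = (\<lambda>s. A *v (y - x) + s *\<^sub>R (A *v axis j 1))"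
      by (simp add: matrix_vector_right_distrib matrix_vector_mult_diff_distrib matrix_vector_mult_scaleR algebra_simps)
    then show ?thesis
      by (auto intro!: derivative_eq_intros)
  qed
  then show ?thesis
    by (auto simp: has_partials_def intro!: continuous_intros continuous_on_matrix_vector_mult simp del: matrix_vector_mult_diff_distrib)
qed

lemma det_columns: "det (\<chi> j. A *v axis j 1) = det (A :: real ^ 'n::finite ^ 'n)"
proof -
  have "(\<chi> j. A *v axis j 1) = transpose A"
    by (simp add: matrix_vector_mult_basis column_def transpose_def)
  then show ?thesis by simp
qed

lemma eventually_less_at_right_0: "0 < m \<Longrightarrow> \<forall>\<^sub>F r in at_right (0::real). r < m"
  using eventually_at_right_field by blast

text \<open>The Jacobian is constant, so the integral is \<open>det A\<close> times that of a
  nonnegative bump which is positive at the centre.\<close>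

lemma degree_integral_linear:
  fixes A :: "real ^ 'n::finite ^ 'n"
  assumes "det A \<noteq> 0" "0 < r" "0 < d"
  shows "0 < sgn (det A) * degree_integral (cball x r) d (\<lambda>y. A *v (y - x)) (\<lambda>j y. A *v axis j 1)"
proof -
  have "0 < integral (cball x r) (\<lambda>y. bump d (A *v (y - x)))"
    using assms by (intro integral_pos_cball continuous_on_bump continuous_on_matrix_vector_mult continuous_intros)
      (auto intro: bump_nonneg bump_pos)
  moreover have "sgn (det A) * det A > 0"
    using assms(1) by (simp add: sgn_if)
  ultimately have "0 < integral (cball x r) (\<lambda>y. bump d (A *v (y - x))) * (sgn (det A) * det A)"
    by (rule mult_pos_pos)
  then show ?thesis
    by (simp add: degree_integral_def det_columns mult_ac)
qed

text \<open>
  The degree integral of a polynomial approximation of \<open>f\<close> localises at the zeros of \<open>f\<close>, each of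
  which contributes with the sign of its determinant.
\<close>

lemma degree_integral_local:
  fixes f :: "real ^ 'n::finite \<Rightarrow> real ^ 'n"
  assumes g: "has_partials g D E"
    and near: "\<And>x. x \<in> cball c \<rho> \<Longrightarrow> norm (f x - g x) < d"
    and X: "finite X" "X \<noteq> {}" and r: "0 < r"
    and sub: "\<And>x. x \<in> X \<Longrightarrow> cball x r \<subseteq> cball c \<rho>"
    and disj: "\<And>x y. x \<in> X \<Longrightarrow> y \<in> X \<Longrightarrow> x \<noteq> y \<Longrightarrow> 2 * r < dist x y"
    and aff: "\<And>x y. x \<in> X \<Longrightarrow> y \<in> cball x r \<Longrightarrow> f y = A x *v (y - x)"
    and s: "\<And>x. x \<in> X \<Longrightarrow> sgn (det (A x)) = s" "s \<noteq> 0"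
    and away: "\<And>y. y \<in> cball c \<rho> \<Longrightarrow> (\<And>x. x \<in> X \<Longrightarrow> r \<le> dist x y) \<Longrightarrow> 2 * d \<le> norm (f y)"
    and d: "0 < d"
  shows "degree_integral (cball c \<rho>) d g D \<noteq> 0"
proof -
  define h where "h y = bump d (g y) * det (\<chi> j. D j y)" for y
  have cont_h: "continuous_on S h" for S
    using g unfolding h_def has_partials_def
    by (intro continuous_intros continuous_on_bump continuous_on_det_rows) (auto intro: continuous_on_subset)
  \<comment> \<open>The margin \<open>2 * d\<close> exceeds the approximation error by at least
    \<open>d\<close>, so \<open>g y\<close> lies outside the support of the bump.\<close>
  have h0: "h y = 0" if "y \<in> cball c \<rho>" "\<And>x. x \<in> X \<Longrightarrow> r \<le> dist x y" for y
  proof -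
    have "2 * d \<le> norm (f y)" using away that by blast
    moreover have "norm (f y) \<le> norm (g y) + norm (f y - g y)"
      by (metis norm_triangle_sub)
    ultimately have "d \<le> norm (g y)" using near[OF that(1)] by linarith
    then show ?thesis using d by (simp add: h_def bump_eq_0)
  qed
  have split: "(if y \<in> cball c \<rho> then h y else 0) = (\<Sum>x\<in>X. if y \<in> cball x r then h y else 0)" for y
  proof (cases "\<exists>x\<in>X. y \<in> cball x r")
    case True
    then obtain x where x: "x \<in> X" "y \<in> cball x r" by blast
    have "y \<notin> cball z r" if "z \<in> X" "z \<noteq> x" for z
    proof
      assume "y \<in> cball z r"
      then have "dist x z \<le> 2 * r"
        using x(2) dist_triangle[of x z y] by (simp add: dist_commute)
      then show False using disj[of x z] x(1) that by simp
    qed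
    then have "(\<Sum>z\<in>X. if y \<in> cball z r then h y else 0) = (\<Sum>z\<in>X. if z = x then h y else 0)"
      using x by (intro sum.cong) auto
    also have "\<dots> = h y"
      using x(1) X(1) by simp
    finally show ?thesis
      using x sub[of x] by auto
  next
    case False
    then show ?thesis
      using h0[of y] by (force intro!: sum.neutral[symmetric])
  qed
  have int_h: "h integrable_on cball x r" for x
    by (intro integrable_on_compact cont_h) simp
  have "degree_integral (cball c \<rho>) d g D = integral UNIV (\<lambda>y. if y \<in> cball c \<rho> then h y else 0)"
    by (simp only: integral_restrict_UNIV degree_integral_def h_def[abs_def])
  also have "\<dots> = (\<Sum>x\<in>X. integral UNIV (\<lambda>y. if y \<in> cball x r then h y else 0))"
    unfolding split using X(1) int_h by (intro integral_sum) (auto simp only: integrable_restrict_UNIV)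
  also have "\<dots> = (\<Sum>x\<in>X. degree_integral (cball x r) d g D)"
    by (simp only: integral_restrict_UNIV degree_integral_def h_def[abs_def])
  \<comment> \<open>On each small ball \<open>g\<close> is deformed into the affine piece of
    \<open>f\<close>. On its sphere the deformed map is \<open>f\<close> minus at most the
    approximation error, hence of norm at least \<open>d\<close>.\<close>
  also have "\<dots> = (\<Sum>x\<in>X. degree_integral (cball x r) d (\<lambda>y. A x *v (y - x)) (\<lambda>j y. A x *v axis j 1))"
  proof (intro sum.cong refl degree_integral_homotopy[OF g has_partials_linear])
    fix x t y assume x: "x \<in> X" and t: "0 \<le> t" "t \<le> (1::real)" and y: "dist x y = r"
    have yB: "y \<in> cball c \<rho>" using sub[OF x] y by auto
    have "r \<le> dist z y" if "z \<in> X" for z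
      using disj[OF x that] y dist_triangle[of x z y] by (cases "z = x") (auto simp: dist_commute)
    then have "2 * d \<le> norm (f y)" using away yB by blast
    moreover have "g y + t *\<^sub>R (A x *v (y - x) - g y) = f y - (1 - t) *\<^sub>R (f y - g y)"
      using aff[OF x, of y, symmetric] y by (simp del: matrix_vector_mult_diff_distrib) (simp add: algebra_simps)
    moreover have "norm ((1 - t) *\<^sub>R (f y - g y)) \<le> norm (f y - g y)"
      using t mult_right_mono[of "1 - t" 1 "norm (f y - g y)"] by simp
    moreover have "norm (f y - (1 - t) *\<^sub>R (f y - g y)) \<ge> norm (f y) - norm ((1 - t) *\<^sub>R (f y - g y))"
      by (rule norm_triangle_ineq2)
    ultimately show "d \<le> norm (g y + t *\<^sub>R (A x *v (y - x) - g y))"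
      using near[OF yB] by (smt (verit))
  qed (use d in auto)
  \<comment> \<open>Multiplication by the common sign makes every local contribution positive, so
    they cannot cancel.\<close>
  finally have "s * degree_integral (cball c \<rho>) d g D
      = (\<Sum>x\<in>X. s * degree_integral (cball x r) d (\<lambda>y. A x *v (y - x)) (\<lambda>j y. A x *v axis j 1))"
    by (simp add: sum_distrib_left)
  also have "\<dots> > 0"
  proof (rule sum_pos[OF X])
    fix x assume "x \<in> X"
    then show "0 < s * degree_integral (cball x r) d (\<lambda>y. A x *v (y - x)) (\<lambda>j y. A x *v axis j 1)"
      using degree_integral_linear[of "A x" r d x] s(1)[of x] s(2) r d by (cases "det (A x) = 0") auto
  qed
  finally show ?thesis by auto
qed

text \<open>A Rouche argument: closeness on the sphere gives a homotopy from \<open>f\<close> to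
  \<open>q\<close> without zeros there, and the zeros of \<open>f\<close> all count with sign
  \<open>s\<close>. A map \<open>q\<close> without zeros would be bounded away from 0 on the ball,
  and its degree integral would vanish once \<open>d\<close> is small.\<close>

theorem zero_exists_of_close_on_sphere:
  fixes f q :: "real ^ 'n::finite \<Rightarrow> real ^ 'n"
  assumes cont: "continuous_on (cball c \<rho>) f" "continuous_on (cball c \<rho>) q"
    and fin: "finite {x \<in> cball c \<rho>. f x = 0}" "{x \<in> cball c \<rho>. f x = 0} \<noteq> {}"
    and s: "s \<noteq> 0"
    and loc: "\<And>x. x \<in> cball c \<rho> \<Longrightarrow> f x = 0 \<Longrightarrow>
      \<exists>A \<epsilon>. 0 < \<epsilon> \<and> sgn (det A) = s \<and> (\<forall>y\<in>ball x \<epsilon>. f y = A *v (y - x))"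
    and close: "\<And>x. dist c x = \<rho> \<Longrightarrow> norm (q x - f x) < norm (f x)"
  shows "\<exists>x\<in>cball c \<rho>. q x = 0"
proof (rule ccontr)
  assume "\<not> ?thesis"
  then have q_nz: "q x \<noteq> 0" if "x \<in> cball c \<rho>" for x using that by blast
  define X where "X = {x \<in> cball c \<rho>. f x = 0}"
  have X: "finite X" "X \<noteq> {}" using fin by (auto simp: X_def)
  have "\<forall>x\<in>X. \<exists>A \<epsilon>. 0 < \<epsilon> \<and> sgn (det A) = s \<and> (\<forall>y\<in>ball x \<epsilon>. f y = A *v (y - x))"
    using loc by (auto simp: X_def)
  then obtain A \<epsilon> where A: "\<And>x. x \<in> X \<Longrightarrow> 0 < \<epsilon> x" "\<And>x. x \<in> X \<Longrightarrow> sgn (det (A x)) = s"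
    "\<And>x y. x \<in> X \<Longrightarrow> y \<in> ball x (\<epsilon> x) \<Longrightarrow> f y = A x *v (y - x)"
    by metis
  \<comment> \<open>The strict inequality \<open>close\<close> excludes zeros of \<open>f\<close> on
    the sphere.\<close>
  have inside: "dist c x < \<rho>" if "x \<in> X" for x
    using that close[of x] by (cases "dist c x = \<rho>") (auto simp: X_def)
  have "\<forall>\<^sub>F r in at_right 0. \<forall>x\<in>X. r < \<epsilon> x \<and> r < \<rho> - dist c x \<and> (\<forall>y\<in>X. x \<noteq> y \<longrightarrow> r < dist x y / 2)"
    using X(1) A(1) inside
    by (intro eventually_ball_finite ballI eventually_conj)
      (auto intro!: eventually_less_at_right_0 simp del: less_divide_eq_numeral1)
  moreover have "\<forall>\<^sub>F r in at_right (0::real). 0 < r"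
    by (simp add: eventually_at_right_less)
  ultimately have "\<forall>\<^sub>F r in at_right 0. 0 < r \<and> (\<forall>x\<in>X. r < \<epsilon> x \<and> r < \<rho> - dist c x \<and> (\<forall>y\<in>X. x \<noteq> y \<longrightarrow> r < dist x y / 2))"
    by eventually_elim auto
  then obtain r where r: "0 < r" "\<And>x. x \<in> X \<Longrightarrow> r < \<epsilon> x" "\<And>x. x \<in> X \<Longrightarrow> r < \<rho> - dist c x"
    "\<And>x y. x \<in> X \<Longrightarrow> y \<in> X \<Longrightarrow> x \<noteq> y \<Longrightarrow> r < dist x y / 2"
    using eventually_happens'[OF trivial_limit_at_right_real] that by blast
  define S where "S = cball c \<rho> - (\<Union>x\<in>X. ball x r)"
  have S: "compact S" "S \<subseteq> cball c \<rho>"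
    unfolding S_def by (auto intro!: compact_diff)
  obtain d1 where d1: "0 < d1" "\<And>x. x \<in> cball c \<rho> \<Longrightarrow> d1 \<le> norm (q x)"
    by (rule continuous_on_compact_pos_lower_bound[of "cball c \<rho>" "\<lambda>x. norm (q x)"])
      (use cont q_nz in \<open>auto intro!: continuous_intros\<close>)
  obtain d2 where d2: "0 < d2" "\<And>x. x \<in> S \<Longrightarrow> d2 \<le> norm (f x)"
  proof (rule continuous_on_compact_pos_lower_bound[of S "\<lambda>x. norm (f x)"])
    show "0 < norm (f x)" if "x \<in> S" for x
      using that r(1) by (force simp: S_def X_def)
  qed (use S cont in \<open>auto intro!: continuous_intros intro: continuous_on_subset\<close>)
  obtain d3 where d3: "0 < d3" "\<And>x. x \<in> sphere c \<rho> \<Longrightarrow> d3 \<le> norm (f x) - norm (q x - f x)"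
    by (rule continuous_on_compact_pos_lower_bound[of "sphere c \<rho>" "\<lambda>x. norm (f x) - norm (q x - f x)"])
      (use cont close in \<open>auto intro!: continuous_intros intro: continuous_on_subset\<close>)
  \<comment> \<open>Three gaps of size at least \<open>2 * d\<close> remain: for \<open>q\<close> on
    the ball, for \<open>f\<close> away from its zeros, and between \<open>f\<close> and
    \<open>q - f\<close> on the sphere. Replacing \<open>f\<close> and \<open>q\<close> by
    polynomials costs less than \<open>d\<close>.\<close>
  define d where "d = min d1 (min d2 d3) / 2"
  have d: "0 < d" "2 * d \<le> d1" "2 * d \<le> d2" "2 * d \<le> d3"
    using d1(1) d2(1) d3(1) by (auto simp: d_def)
  obtain g where g: "polynomial_function g" "\<And>x. x \<in> cball c \<rho> \<Longrightarrow> norm (f x - g x) < d"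
    using Stone_Weierstrass_polynomial_function[OF compact_cball cont(1) d(1)] by blast
  obtain k where k: "polynomial_function k" "\<And>x. x \<in> cball c \<rho> \<Longrightarrow> norm (q x - k x) < d"
    using Stone_Weierstrass_polynomial_function[OF compact_cball cont(2) d(1)] by blast
  obtain Dg Eg where Dg: "has_partials g Dg Eg" using polynomial_function_has_partials[OF g(1)] .
  obtain Dk Ek where Dk: "has_partials k Dk Ek" using polynomial_function_has_partials[OF k(1)] .

  have "degree_integral (cball c \<rho>) d g Dg \<noteq> 0"
  proof (rule degree_integral_local[OF Dg g(2) X r(1) _ _ _ A(2) s _ d(1)])
    show "cball x r \<subseteq> cball c \<rho>" if "x \<in> X" for x
      using r(3)[OF that] by (auto simp: cball_subset_cball_iff dist_commute)
    show "2 * r < dist x y" if "x \<in> X" "y \<in> X" "x \<noteq> y" for x y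
      using r(4)[OF that] by simp
    show "f y = A x *v (y - x)" if "x \<in> X" "y \<in> cball x r" for x y
      using A(3)[of x y] r(2)[of x] that by auto
    show "2 * d \<le> norm (f y)" if "y \<in> cball c \<rho>" "\<And>x. x \<in> X \<Longrightarrow> r \<le> dist x y" for y
      using that d2(2)[of y] d(3) by (force simp: S_def)
  qed
  moreover have "degree_integral (cball c \<rho>) d g Dg = degree_integral (cball c \<rho>) d k Dk"
  proof (rule degree_integral_homotopy[OF Dg Dk])
    fix t x assume t: "0 \<le> t" "t \<le> (1::real)" and x: "dist c x = \<rho>"
    \<comment> \<open>Here \<open>u + v\<close> is the homotopy between the exact maps and
      \<open>w\<close> collects both approximation errors; \<open>norm u - norm v\<close> is at
      least \<open>2 * d\<close> and \<open>norm w\<close> at most \<open>d\<close>.\<close>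
    define u v w where "u = f x" and "v = t *\<^sub>R (q x - f x)" and "w = (1 - t) *\<^sub>R (f x - g x) + t *\<^sub>R (q x - k x)"
    have "g x + t *\<^sub>R (k x - g x) = u + v - w"
      by (simp add: u_def v_def w_def algebra_simps)
    moreover have "norm v \<le> norm (q x - f x)"
      using t mult_right_mono[of t 1 "norm (q x - f x)"] by (simp add: v_def)
    moreover have "norm w \<le> d"
    proof -
      have "norm w \<le> (1 - t) * norm (f x - g x) + t * norm (q x - k x)"
        using t norm_triangle_ineq[of "(1 - t) *\<^sub>R (f x - g x)" "t *\<^sub>R (q x - k x)"] by (simp add: w_def)
      also have "\<dots> \<le> (1 - t) * d + t * d"
        using t x g(2)[of x] k(2)[of x] by (intro add_mono mult_left_mono) auto
      finally show ?thesis by (simp add: algebra_simps)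
    qed
    moreover have "norm (u + v - w) \<ge> norm u - norm v - norm w"
      using norm_triangle_ineq2[of "u + v" w] norm_diff_ineq[of u v] by linarith
    moreover have "2 * d \<le> norm u - norm (q x - f x)"
      using d3(2)[of x] x d(4) by (simp add: u_def)
    ultimately show "d \<le> norm (g x + t *\<^sub>R (k x - g x))"
      using d(1) by (smt (verit))
  qed (use d in auto)
  moreover have "degree_integral (cball c \<rho>) d k Dk = 0"
  proof -
    have "bump d (k x) = 0" if "x \<in> cball c \<rho>" for x
    proof -
      have "norm (q x) \<le> norm (k x) + norm (q x - k x)"
        by (metis norm_triangle_sub)
      then show ?thesis
        using d1(2)[OF that] k(2)[OF that] d by (intro bump_eq_0) auto
    qed
    then have "degree_integral (cball c \<rho>) d k Dk = integral (cball c \<rho>) (\<lambda>x. 0)"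
      unfolding degree_integral_def by (intro integral_cong) auto
    then show ?thesis by simp
  qed
  ultimately show False by simp
qed

section \<open>Coherently oriented piecewise linear maps\<close>

text \<open>Distinct matrices differ in some row, and that row confines the set to a hyperplane;
  equal matrices with distinct offsets agree nowhere.\<close>

lemma negligible_affine_agree:
  fixes A A' :: "real ^ 'n ^ 'm" and b b' :: "real ^ 'm"
  assumes "(A, b) \<noteq> (A', b')"
  shows "negligible {x. A *v x + b = A' *v x + b'}"
proof (cases "A = A'")
  case True
  then show ?thesis using assms by simp
next
  case False
  then obtain i where i: "row i A \<noteq> row i A'"
    by (auto simp: vec_eq_iff row_def)
  have "{x. A *v x + b = A' *v x + b'} \<subseteq> {x. (row i A - row i A') \<bullet> x = b' $ i - b $ i}"
  proof clarify
    fix x assume "A *v x + b = A' *v x + b'"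
    then have "(A *v x + b) $ i = (A' *v x + b') $ i" by simp
    then show "(row i A - row i A') \<bullet> x = b' $ i - b $ i"
      by (simp add: matrix_vector_mul_component row_def inner_diff_left vec_nth_inverse vec_lambda_eta)
  qed
  moreover have "negligible {x. (row i A - row i A') \<bullet> x = b' $ i - b $ i}"
    using i by (intro negligible_hyperplane) auto
  ultimately show ?thesis by (rule negligible_subset[rotated])
qed

text \<open>A shift on either side of \<open>A\<close> lets one statement serve both the affine
  pieces and their inverses.\<close>

lemma negligible_affine_image:
  fixes A :: "real ^ 'n ^ 'n"
  assumes "negligible M"
  shows "negligible ((\<lambda>x. A *v (x + a) + b) ` M)"
proof (rule negligible_differentiable_image_negligible[OF _ assms])
  show "(\<lambda>x. A *v (x + a) + b) differentiable_on M"
    unfolding matrix_vector_right_distrib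
    by (intro linear_imp_differentiable_on derivative_intros differentiable_on_add differentiable_on_const) simp
qed simp

text \<open>The margin on the sphere has to absorb three things at once: the deviation of
  \<open>Q\<close>, the target \<open>y\<close>, and the passage from 0 to a nearby regular value.
  This fixes the fractions of the sphere minimum used in the proof.\<close>

theorem coherently_oriented_covering:
  fixes P :: "real ^ 'n::finite \<Rightarrow> real ^ 'n"
  assumes U: "open U" and xs: "xs \<in> U" "P xs = 0" and P: "coherently_oriented_on U P"
  obtains \<rho> m where "0 < \<rho>" "0 < m" "cball xs \<rho> \<subseteq> U"
    "\<And>Q (y :: real ^ 'n). continuous_on (cball xs \<rho>) Q \<Longrightarrow>
      (\<And>x. x \<in> cball xs \<rho> \<Longrightarrow> norm (Q x - P x) + norm y \<le> m) \<Longrightarrow> \<exists>x\<in>cball xs \<rho>. Q x = y"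
proof -
  obtain S s where sel: "selection_functions S P" and s1: "s \<in> {-1, 1}"
    and orient1: "\<forall>(A, b)\<in>S. \<forall>V. open V \<and> V \<noteq> {} \<and> V \<subseteq> U \<and> active_on V P A b \<longrightarrow> sgn (det A) = s"
    using P unfolding coherently_oriented_on_def by blast
  have s: "s \<noteq> 0" using s1 by auto
  have orient: "sgn (det A) = s"
    if "(A, b) \<in> S" "open V" "V \<noteq> {}" "V \<subseteq> U" "active_on V P A b" for A b V
    using orient1 that by blast
  have S: "finite S" and contP: "continuous_on UNIV P"
    and cover: "\<And>x. \<exists>(A, b)\<in>S. P x = A *v x + b"
    using sel by (auto simp: selection_functions_def)
  define ev where "ev p x = fst p *v x + snd p" for p :: "(real ^ 'n ^ 'n) \<times> (real ^ 'n)" and x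
  have cont_ev: "continuous_on V (ev p)" for V p
    unfolding ev_def by (intro continuous_intros continuous_on_matrix_vector_mult)
  \<comment> \<open>All kinks in \<open>U\<close> lie in \<open>N\<close>: elsewhere only one
    selection function takes the value of \<open>P\<close>, and by continuity no other one does
    nearby.\<close>
  define N where "N = (\<Union>p\<in>S. \<Union>q\<in>S - {p}. {x. ev p x = ev q x})"
  have negN: "negligible N"
    unfolding N_def ev_def using S
    by (intro negligible_Union finite_imageI) (auto intro!: negligible_Union negligible_affine_agree simp: prod_eq_iff)
  have loc: "\<exists>p\<in>S. \<exists>\<epsilon>>0. sgn (det (fst p)) = s \<and> (\<forall>y\<in>ball x \<epsilon>. P y = ev p y)"
    if x: "x \<in> U" "x \<notin> N" for x
  proof -
    obtain p where p: "p \<in> S" "P x = ev p x"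
      using cover[of x] by (auto simp: ev_def)
    have "\<forall>\<^sub>F y in nhds x. P y \<noteq> ev q y" if "q \<in> S - {p}" for q
    proof -
      have "P x \<noteq> ev q x"
        using that p x(2) by (auto simp: N_def)
      moreover have "open {y. P y \<noteq> ev q y}"
        by (intro open_Collect_neq contP cont_ev)
      ultimately show ?thesis
        by (auto simp: eventually_nhds)
    qed
    then have "\<forall>\<^sub>F y in nhds x. \<forall>q\<in>S - {p}. P y \<noteq> ev q y"
      using S by (intro eventually_ball_finite) auto
    moreover have "\<forall>\<^sub>F y in nhds x. y \<in> U"
      using U x(1) by (rule eventually_nhds_in_open)
    ultimately have "\<forall>\<^sub>F y in nhds x. P y = ev p y \<and> y \<in> U"
    proof eventually_elim
      case (elim y)
      then show ?case using cover[of y] by (force simp: ev_def)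
    qed
    then obtain \<epsilon> where \<epsilon>: "0 < \<epsilon>" "\<And>y. y \<in> ball x \<epsilon> \<Longrightarrow> P y = ev p y \<and> y \<in> U"
      unfolding eventually_nhds_metric by (auto simp: dist_commute)
    have "ball x \<epsilon> \<subseteq> U" using \<epsilon>(2) by blast
    then have "sgn (det (fst p)) = s"
      using orient[of "fst p" "snd p" "ball x \<epsilon>"] p(1) \<epsilon> by (auto simp: active_on_def ev_def)
    then show ?thesis using p(1) \<epsilon> by blast
  qed
  define T where "T = {p \<in> S. sgn (det (fst p)) = s}"
  \<comment> \<open>The points of \<open>U\<close> missed by the pieces of sign \<open>s\<close>
    form an open subset of \<open>N\<close>. An open negligible set is empty, so these pieces
    describe \<open>P\<close> even on the kinks.\<close>
  have cover_T: "\<exists>p\<in>T. P x = ev p x" if "x \<in> U" for x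
  proof -
    define C where "C = (\<Union>p\<in>T. {x. P x = ev p x})"
    have "closed C"
      unfolding C_def T_def using S by (intro closed_UN ballI closed_Collect_eq contP cont_ev) auto
    then have "open (U - C)"
      using U by auto
    moreover have "U - C \<subseteq> N"
    proof
      fix x assume x: "x \<in> U - C"
      show "x \<in> N"
      proof (rule ccontr)
        assume "x \<notin> N"
        then show False
          using loc[of x] x by (force simp: C_def T_def)
      qed
    qed
    ultimately have "U - C = {}"
      using open_not_negligible negligible_subset[OF negN] by blast
    then show ?thesis using that by (auto simp: C_def)
  qed
  have inv_T: "\<exists>B. \<forall>x y. ev p x = y \<longrightarrow> x = B *v (y - snd p)" if "p \<in> T" for p
  proof -
    have "invertible (fst p)"
      using that s by (auto simp: T_def invertible_det_nz)
    then obtain B where "B ** fst p = mat 1"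
      by (auto simp: invertible_def)
    then have "B *v (fst p *v x) = x" for x
      by (simp add: matrix_vector_mul_assoc)
    then show ?thesis
      by (intro exI[of _ B]) (auto simp: ev_def)
  qed
  then obtain B where B: "\<And>p x y. p \<in> T \<Longrightarrow> ev p x = y \<Longrightarrow> x = B p *v (y - snd p)"
    by metis
  have finT: "finite T" using S by (simp add: T_def)
  \<comment> \<open>Pieces in \<open>T\<close> are invertible, so each contributes at most one
    preimage.\<close>
  have fin: "finite {x \<in> U. P x = y}" for y
  proof (rule finite_subset)
    show "{x \<in> U. P x = y} \<subseteq> (\<lambda>p. B p *v (y - snd p)) ` T"
      using cover_T B by fastforce
  qed (use finT in simp)

  have "open (U - ({x \<in> U. P x = 0} - {xs}))"
    using U fin[of 0] by (intro open_Diff finite_imp_closed) auto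
  moreover have "xs \<in> U - ({x \<in> U. P x = 0} - {xs})"
    using xs by auto
  ultimately obtain \<rho> where \<rho>: "0 < \<rho>" "cball xs \<rho> \<subseteq> U - ({x \<in> U. P x = 0} - {xs})"
    by (auto simp: open_contains_cball)
  have \<rho>U: "x \<in> U" if "x \<in> cball xs \<rho>" for x
    using that \<rho>(2) by blast
  have contP': "continuous_on V P" for V
    using contP by (rule continuous_on_subset) simp
  obtain m where m: "0 < m" "\<And>x. x \<in> sphere xs \<rho> \<Longrightarrow> m \<le> norm (P x)"
  proof (rule continuous_on_compact_pos_lower_bound[of "sphere xs \<rho>" "\<lambda>x. norm (P x)"])
    show "0 < norm (P x)" if "x \<in> sphere xs \<rho>" for x
      using that \<rho> by (cases "x = xs") auto
  qed (auto intro!: continuous_intros contP')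

  \<comment> \<open>The bound \<open>m / 4\<close> settles the sphere estimate: less than
    \<open>m / 2 + m / 4\<close> on one side, more than \<open>m - m / 4\<close> on the
    other.\<close>
  define W where "W = ball xs \<rho> \<inter> {x. norm (P x) < m / 4}"
  have "open W"
    unfolding W_def by (intro open_Int open_ball open_Collect_less continuous_intros contP)
  moreover have "xs \<in> W"
    using \<rho>(1) m(1) xs by (simp add: W_def)
  moreover define M where "M = (\<Union>p\<in>S. ev p ` N)"
  have M: "P ` N \<subseteq> M"
  proof
    fix y assume "y \<in> P ` N"
    then obtain x where "x \<in> N" "y = P x" by blast
    moreover obtain p where "p \<in> S" "P x = ev p x"
      using cover[of x] by (auto simp: ev_def)
    ultimately show "y \<in> M" by (auto simp: M_def)
  qed
  have "negligible (ev p ` N)" for p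
    using negligible_affine_image[OF negN, of "fst p" 0 "snd p"] by (simp add: ev_def[abs_def])
  then have "negligible M"
    unfolding M_def using S by (auto intro!: negligible_Union)
  then have "negligible ((\<lambda>y. B p *v (y - snd p)) ` M)" for p
    using negligible_affine_image[of M "B p" "- snd p" 0] by simp
  \<comment> \<open>The regular value is chosen through a point \<open>x0\<close> of the open set
    \<open>W\<close>, so that it is attained in the ball. Avoiding the preimages of \<open>M\<close>
    under the pieces in \<open>T\<close> keeps \<open>P x0\<close> out of \<open>M\<close>, which
    contains all values of \<open>P\<close> on \<open>N\<close>.\<close>
  then have neg: "negligible (N \<union> (\<Union>p\<in>T. (\<lambda>y. B p *v (y - snd p)) ` M))"
    using negN finT by (auto intro!: negligible_Un negligible_Union)
  ultimately obtain x0 where x0: "x0 \<in> W" "x0 \<notin> N \<union> (\<Union>p\<in>T. (\<lambda>y. B p *v (y - snd p)) ` M)"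
    using open_not_negligible[of W] negligible_subset[OF neg, of W] by blast
  have x0U: "x0 \<in> U" using x0(1) \<rho>U[of x0] by (simp add: W_def)
  have regular: "P x0 \<notin> P ` N"
  proof
    assume "P x0 \<in> P ` N"
    then have "P x0 \<in> M" using M by blast
    moreover obtain p where "p \<in> T" "P x0 = ev p x0" using cover_T[OF x0U] by blast
    ultimately have "x0 \<in> (\<Union>p\<in>T. (\<lambda>y. B p *v (y - snd p)) ` M)"
      using B[of p x0 "P x0"] by auto
    then show False using x0(2) by blast
  qed
  show thesis
  proof (rule that[of \<rho> "m / 2"])
    fix Q and y :: "real ^ 'n"
    assume Q: "continuous_on (cball xs \<rho>) Q" "\<And>x. x \<in> cball xs \<rho> \<Longrightarrow> norm (Q x - P x) + norm y \<le> m / 2"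
    have "\<exists>x\<in>cball xs \<rho>. Q x - y = 0"
    proof (rule zero_exists_of_close_on_sphere[where f = "\<lambda>x. P x - P x0" and s = s])
      show "finite {x \<in> cball xs \<rho>. P x - P x0 = 0}"
        using \<rho>U by (intro finite_subset[OF _ fin[of "P x0"]]) auto
      show "{x \<in> cball xs \<rho>. P x - P x0 = 0} \<noteq> {}"
        using x0(1) by (auto simp: W_def intro!: exI[of _ x0])
      show "\<exists>A \<epsilon>. 0 < \<epsilon> \<and> sgn (det A) = s \<and> (\<forall>y\<in>ball x \<epsilon>. P y - P x0 = A *v (y - x))"
        if x: "x \<in> cball xs \<rho>" "P x - P x0 = 0" for x
      proof -
        have "x \<in> U" "x \<notin> N" using x \<rho>U[of x] regular by (auto simp: image_iff)
        then obtain p \<epsilon> where p: "0 < \<epsilon>" "sgn (det (fst p)) = s" "\<And>y. y \<in> ball x \<epsilon> \<Longrightarrow> P y = ev p y"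
          using loc by metis
        have "P y - P x0 = fst p *v (y - x)" if "y \<in> ball x \<epsilon>" for y
          using p(3)[OF that] p(3)[of x] p(1) x(2) by (simp add: ev_def algebra_simps)
        then show ?thesis using p by blast
      qed
      show "norm (Q x - y - (P x - P x0)) < norm (P x - P x0)" if "dist xs x = \<rho>" for x
      proof -
        have "norm (Q x - y - (P x - P x0)) \<le> norm (Q x - P x) + norm y + norm (P x0)"
          using norm_triangle_ineq[of "Q x - P x - y" "P x0"] norm_triangle_ineq4[of "Q x - P x" y]
          by (simp add: algebra_simps)
        moreover have "norm (P x) - norm (P x0) \<le> norm (P x - P x0)"
          by (rule norm_triangle_ineq2)
        ultimately show ?thesis
          using Q(2)[of x] m(2)[of x] that x0(1) by (auto simp: W_def)
      qed
    qed (use s Q contP' in \<open>auto intro!: continuous_intros\<close>)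
    then show "\<exists>x\<in>cball xs \<rho>. Q x = y" by simp
  qed (use \<rho> \<rho>U m in auto)
qed

section \<open>Comparison of the two linearizations\<close>

lemma run_procedure_Nil [simp]: "run_procedure step [] vs = vs"
  by (simp add: run_procedure_def)

lemma run_procedure_snoc:
  "run_procedure step (p @ [i]) vs = run_procedure step p vs @ [step (run_procedure step p vs) i]"
  by (simp add: run_procedure_def)

lemma length_run_procedure [simp]: "length (run_procedure step p vs) = length vs + length p"
  by (induction p rule: rev_induct) (simp_all add: run_procedure_snoc)

lemma run_procedure_nth_input: "k < length vs \<Longrightarrow> run_procedure step p vs ! k = vs ! k"
  by (induction p rule: rev_induct) (simp_all add: run_procedure_snoc nth_append)

text \<open>A step sees only the values computed before it. If it ignores later entries, the
  finished list may replace that prefix, and the fold turns into equations between final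
  values.\<close>

lemma run_procedure_nth_step:
  assumes "i < length p"
    and "\<And>ws. step (take (length vs + i) ws) (p ! i) = step ws (p ! i)"
  shows "run_procedure step p vs ! (length vs + i) = step (run_procedure step p vs) (p ! i)"
  using assms
proof (induction p rule: rev_induct)
  case (snoc x p)
  show ?case
  proof (cases "i < length p")
    case True
    then have "run_procedure step p vs ! (length vs + i) = step (run_procedure step p vs) (p ! i)"
      using snoc by (simp add: nth_append)
    moreover have "step (run_procedure step (p @ [x]) vs) (p ! i) = step (run_procedure step p vs) (p ! i)"
      using snoc.prems(2)[of "run_procedure step (p @ [x]) vs"] snoc.prems(2)[of "run_procedure step p vs"] True
      by (simp add: run_procedure_snoc nth_append)
    ultimately show ?thesis
      using True by (simp add: run_procedure_snoc nth_append)
  next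
    case False
    then have i: "i = length p" using snoc.prems(1) by simp
    then show ?thesis
      using snoc.prems(2)[of "run_procedure step (p @ [x]) vs"]
      by (simp add: run_procedure_snoc nth_append)
  qed
qed simp

lemma step_take:
  assumes "operands i \<subseteq> {..<m}"
  shows "eval_step (take m d) i = eval_step d i"
    and "tangent_step v (take m d) i = tangent_step v d i"
    and "secant_step vc vh (take m d) i = secant_step vc vh d i"
  using assms by (cases i; simp)+

lemma length_inputs [simp]: "length (inputs (e :: nat \<Rightarrow> 'n::finite) x) = CARD('n)"
  by (simp add: inputs_def)

lemma nth_inputs: "k < CARD('n) \<Longrightarrow> inputs (e :: nat \<Rightarrow> 'n::finite) x ! k = x $ e k"
  by (simp add: inputs_def)

section \<open>Secant slopes and asymptotic estimates\<close>

text \<open>The factor with which an \<open>Elem\<close> instruction multiplies the increment in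
  \<open>secant_step\<close>.\<close>

definition secant_slope :: "(real \<Rightarrow> real) \<Rightarrow> real \<Rightarrow> real \<Rightarrow> real" where
  "secant_slope \<phi> s t = (if s = t then deriv \<phi> ((s + t) / 2) else (\<phi> t - \<phi> s) / (t - s))"

text \<open>By the mean value theorem every slope is \<open>deriv \<phi> u\<close> with
  \<open>u\<close> between \<open>s\<close> and \<open>t\<close>, also when \<open>s = t\<close>,
  and \<open>deriv \<phi>\<close> is Lipschitz near \<open>v\<close>. The ball lies inside
  \<open>D\<close>, so the whole interval is in the domain.\<close>

lemma elemental_secant_slope_bound:
  assumes "elemental D \<phi>" "v \<in> D"
  obtains \<delta> L where "0 < \<delta>" "0 \<le> L"
    "\<And>s t. s \<in> ball v \<delta> \<Longrightarrow> t \<in> ball v \<delta> \<Longrightarrow>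
       \<bar>secant_slope \<phi> s t - deriv \<phi> v\<bar> \<le> L * (\<bar>s - v\<bar> + \<bar>t - v\<bar>)"
proof -
  obtain \<delta>0 L where \<delta>0: "0 < \<delta>0" and L: "L-lipschitz_on (ball v \<delta>0 \<inter> D) (deriv \<phi>)"
    using assms unfolding elemental_def by blast
  obtain \<delta>1 where \<delta>1: "0 < \<delta>1" "ball v \<delta>1 \<subseteq> D"
    using assms open_contains_ball unfolding elemental_def by blast
  define \<delta> where "\<delta> = min \<delta>0 \<delta>1"
  have \<delta>: "0 < \<delta>" "ball v \<delta> \<subseteq> ball v \<delta>0 \<inter> D"
    using \<delta>0 \<delta>1 by (auto simp: \<delta>_def)
  have deriv: "(\<phi> has_field_derivative deriv \<phi> u) (at u)" if "u \<in> ball v \<delta>" for u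
    using assms(1) that \<delta>(2) unfolding elemental_def by (blast intro: field_differentiable_derivI)
  have bound: "\<bar>deriv \<phi> u - deriv \<phi> v\<bar> \<le> L * \<bar>u - v\<bar>" if "u \<in> ball v \<delta>" for u
    using lipschitz_onD[OF L, of u v] that \<delta> by (force simp: dist_real_def)
  have mvt: "\<exists>u. s < u \<and> u < t \<and> (\<phi> t - \<phi> s) / (t - s) = deriv \<phi> u"
    if st: "s \<in> ball v \<delta>" "t \<in> ball v \<delta>" "s < t" for s t
  proof -
    have "u \<in> ball v \<delta>" if "s \<le> u" "u \<le> t" for u
      using st that by (auto simp: dist_real_def)
    then have "\<exists>u. s < u \<and> u < t \<and> \<phi> t - \<phi> s = (t - s) * deriv \<phi> u"
      using st(3) deriv by (intro MVT2) auto
    then show ?thesis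
      using st(3) by auto
  qed
  have L0: "0 \<le> L" using L by (rule lipschitz_on_nonneg)
  have "\<bar>secant_slope \<phi> s t - deriv \<phi> v\<bar> \<le> L * (\<bar>s - v\<bar> + \<bar>t - v\<bar>)"
    if st: "s \<in> ball v \<delta>" "t \<in> ball v \<delta>" for s t
  proof -
    have "\<exists>u. min s t \<le> u \<and> u \<le> max s t \<and> secant_slope \<phi> s t = deriv \<phi> u"
    proof (cases s t rule: linorder_cases)
      case less
      then obtain u where "s < u" "u < t" "(\<phi> t - \<phi> s) / (t - s) = deriv \<phi> u"
        using mvt[OF st] by blast
      then show ?thesis using less by (intro exI[of _ u]) (simp add: secant_slope_def)
    next
      case equal
      then show ?thesis by (auto simp: secant_slope_def)
    next
      case greater
      have "(\<phi> t - \<phi> s) / (t - s) = (\<phi> s - \<phi> t) / (s - t)"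
        by (metis minus_diff_eq minus_divide_divide)
      moreover obtain u where "t < u" "u < s" "(\<phi> s - \<phi> t) / (s - t) = deriv \<phi> u"
        using mvt[OF st(2,1) greater] by blast
      ultimately show ?thesis using greater by (intro exI[of _ u]) (simp add: secant_slope_def)
    qed
    then obtain u where u: "min s t \<le> u" "u \<le> max s t" "secant_slope \<phi> s t = deriv \<phi> u" by blast
    have "u \<in> ball v \<delta>" using u st by (auto simp: dist_real_def min_def max_def split: if_splits)
    then have "\<bar>secant_slope \<phi> s t - deriv \<phi> v\<bar> \<le> L * \<bar>u - v\<bar>"
      using bound u(3) by simp
    also have "\<dots> \<le> L * (\<bar>s - v\<bar> + \<bar>t - v\<bar>)"
      using u(1,2) L0 by (intro mult_left_mono) (auto simp: min_def max_def split: if_splits)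
    finally show ?thesis .
  qed
  then show thesis using that \<delta>(1) L0 by blast
qed

lemma bigo_real_bound:
  fixes f g :: "'z \<Rightarrow> real"
  assumes "g \<in> O[F](M)" "\<And>z. \<bar>f z\<bar> \<le> g z"
  shows "f \<in> O[F](M)"
proof -
  have "f \<in> O[F](g)"
    using assms(2) by (intro landau_o.big_mono always_eventually) (smt (verit) real_norm_def)
  then show ?thesis using assms(1) by (rule landau_o.big_trans)
qed

lemma bigo_tendsto_0:
  fixes f M :: "'z \<Rightarrow> real"
  assumes "f \<in> O[F](M)" "(M \<longlongrightarrow> 0) F"
  shows "(f \<longlongrightarrow> 0) F"
proof -
  obtain c where "eventually (\<lambda>z. norm (f z) \<le> c * norm (M z)) F"
    using assms(1) landau_o.bigE by blast
  moreover have "((\<lambda>z. c * norm (M z)) \<longlongrightarrow> 0) F"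
    by (intro tendsto_mult_right_zero tendsto_norm_zero assms(2))
  ultimately show ?thesis by (rule Lim_null_comparison)
qed

text \<open>Since \<open>M\<close> tends to 0, both arguments eventually enter the ball of the
  pointwise estimate.\<close>

lemma elemental_secant_slope_bigo:
  fixes a b M :: "'z \<Rightarrow> real"
  assumes el: "elemental D \<phi>" "v \<in> D"
    and ab: "(\<lambda>z. a z - v) \<in> O[F](M)" "(\<lambda>z. b z - v) \<in> O[F](M)" and M: "(M \<longlongrightarrow> 0) F"
  shows "(\<lambda>z. secant_slope \<phi> (a z) (b z) - deriv \<phi> v) \<in> O[F](M)"
proof -
  obtain \<delta> L where \<delta>: "0 < \<delta>" "0 \<le> L"
    and bound: "\<And>s t. s \<in> ball v \<delta> \<Longrightarrow> t \<in> ball v \<delta> \<Longrightarrow>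
       \<bar>secant_slope \<phi> s t - deriv \<phi> v\<bar> \<le> L * (\<bar>s - v\<bar> + \<bar>t - v\<bar>)"
    using elemental_secant_slope_bound[OF el] by metis
  have near: "\<forall>\<^sub>F z in F. f z \<in> ball v \<delta>" if "(\<lambda>z. f z - v) \<in> O[F](M)" for f
    using tendstoD[OF bigo_tendsto_0[OF that M] \<delta>(1)] by (simp add: dist_real_def abs_minus_commute)
  have "(\<lambda>z. secant_slope \<phi> (a z) (b z) - deriv \<phi> v) \<in> O[F](\<lambda>z. L * (\<bar>a z - v\<bar> + \<bar>b z - v\<bar>))"
    using near[OF ab(1)] near[OF ab(2)]
    by (intro landau_o.big_mono, eventually_elim) (use bound \<delta>(2) in \<open>auto simp: abs_mult\<close>)
  moreover have "(\<lambda>z. L * (\<bar>a z - v\<bar> + \<bar>b z - v\<bar>)) \<in> O[F](M)"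
    using ab by (simp add: sum_in_bigo)
  ultimately show ?thesis by (rule landau_o.big_trans)
qed

text \<open>Split the difference as \<open>a * (b - d) + (a - c) * d\<close>; \<open>a\<close> is
  bounded because \<open>c\<close> is and \<open>M\<close> tends to 0.\<close>

lemma bigo_mult_diff:
  fixes a b c d M :: "'z \<Rightarrow> real"
  assumes "(\<lambda>z. a z - c z) \<in> O[F](M)" "(\<lambda>z. b z - d z) \<in> O[F](M)"
    and "c \<in> O[F](\<lambda>_. 1)" "d \<in> O[F](\<lambda>_. 1)" and M: "(M \<longlongrightarrow> 0) F"
  shows "(\<lambda>z. a z * b z - c z * d z) \<in> O[F](M)"
proof -
  have M1: "M \<in> O[F](\<lambda>_. 1)"
    using M by (intro landau_o.small_imp_big smalloI_tendsto) auto
  have "(\<lambda>z. (a z - c z) + c z) \<in> O[F](\<lambda>_. 1)"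
    using landau_o.big_trans[OF assms(1) M1] assms(3) by (rule sum_in_bigo)
  then have a: "a \<in> O[F](\<lambda>_. 1)" by simp
  have "(\<lambda>z. a z * (b z - d z) + (a z - c z) * d z) \<in> O[F](M)"
    using landau_o.big.mult[OF a assms(2)] landau_o.big.mult[OF assms(1,4)]
    by (intro sum_in_bigo) simp_all
  then show ?thesis by (simp add: algebra_simps)
qed

section \<open>Linearizations of a fixed procedure\<close>

context
  fixes \<Phi> :: "(real set \<times> (real \<Rightarrow> real)) set" and e :: "nat \<Rightarrow> 'n::finite" and p :: "instr list"
  assumes library: "elemental_library \<Phi>"
    and enum: "bij_betw e {..<CARD('n)} UNIV"
    and procedure: "procedure_over \<Phi> CARD('n) p"
begin

lemma operands_bound: "i < length p \<Longrightarrow> operands (p ! i) \<subseteq> {..<CARD('n) + i}"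
  using procedure by (simp add: procedure_over_def)

text \<open>Operands precede the value they produce, so strong induction on positions becomes
  induction along the procedure.\<close>

lemma value_induct [consumes 1, case_names input instr]:
  assumes "k < CARD('n) + length p"
    and "\<And>k. k < CARD('n) \<Longrightarrow> P k"
    and "\<And>i. i < length p \<Longrightarrow> (\<And>j. j \<in> operands (p ! i) \<Longrightarrow> P j) \<Longrightarrow> P (CARD('n) + i)"
  shows "P k"
  using assms(1)
proof (induction k rule: less_induct)
  case (less k)
  show ?case
  proof (cases "k < CARD('n)")
    case False
    then obtain i where i: "k = CARD('n) + i" "i < length p"
      using less.prems by (metis add_less_cancel_left le_Suc_ex not_less)
    show ?thesis
      unfolding i(1)
    proof (rule assms(3)[OF i(2)])
      fix j assume "j \<in> operands (p ! i)"
      then have "j < k" using operands_bound[OF i(2)] i(1) by auto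
      then show "P j" using less.IH less.prems by simp
    qed
  qed (rule assms(2))
qed

lemma proc_values_input: "k < CARD('n) \<Longrightarrow> proc_values e p x ! k = x $ e k"
  by (simp add: proc_values_def run_procedure_nth_input nth_inputs)

lemma proc_values_step:
  "i < length p \<Longrightarrow> proc_values e p x ! (CARD('n) + i) = eval_step (proc_values e p x) (p ! i)"
  using run_procedure_nth_step[of i p eval_step "inputs e x"]
  by (simp add: proc_values_def step_take[OF operands_bound])

lemma length_proc_values: "length (proc_values e p x) = CARD('n) + length p"
  by (simp add: proc_values_def)

lemma outputs_nth:
  assumes "length vs = CARD('n) + length p"
  shows "outputs e vs $ j = vs ! (length p + inv_into {..<CARD('n)} e j)"
    "length p + inv_into {..<CARD('n)} e j < CARD('n) + length p"
proof -
  show "outputs e vs $ j = vs ! (length p + inv_into {..<CARD('n)} e j)"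
    using assms by (simp add: outputs_def)
  have "j \<in> e ` {..<CARD('n)}"
    using enum by (simp add: bij_betw_def)
  from inv_into_into[OF this] show "length p + inv_into {..<CARD('n)} e j < CARD('n) + length p"
    by simp
qed

lemma elemental_instr:
  assumes "i < length p" "p ! i = Elem D \<phi> j"
  shows "elemental D \<phi>"
proof -
  have "(D, \<phi>) \<in> \<Phi>"
    using procedure nth_mem[OF assms(1)] assms(2) unfolding procedure_over_def by metis
  then show ?thesis
    using library by (auto simp: elemental_library_def)
qed

text \<open>This carries the root \<open>xs\<close> of \<open>F\<close> over to the tangent
  linearization at \<open>xs\<close>.\<close>

lemma tangent_increment_0: "tangent_increment e p x0 0 = 0"
proof -
  let ?T = "run_procedure (tangent_step (proc_values e p x0)) p (inputs e (0 :: real ^ 'n))"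
  have step: "?T ! (CARD('n) + i) = tangent_step (proc_values e p x0) ?T (p ! i)" if "i < length p" for i
    using run_procedure_nth_step[of i p _ "inputs e (0 :: real ^ 'n)"] that
    by (simp add: step_take[OF operands_bound])
  have "?T ! k = 0" if "k < CARD('n) + length p" for k
    using that
  proof (induction k rule: value_induct)
    case (input k)
    then show ?case by (simp add: run_procedure_nth_input nth_inputs)
  next
    case (instr i)
    then show ?case unfolding step[OF instr(1)] by (cases "p ! i") auto
  qed
  then show ?thesis
    using outputs_nth[of ?T] by (simp add: tangent_increment_def vec_eq_iff)
qed

lemma continuous_on_secant_linearization:
  "continuous_on S (secant_linearization e p F xc xh)"
proof -
  let ?S = "\<lambda>dx. run_procedure (secant_step (proc_values e p xc) (proc_values e p xh)) p (inputs e dx)"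
  have step: "?S dx ! (CARD('n) + i) = secant_step (proc_values e p xc) (proc_values e p xh) (?S dx) (p ! i)"
    if "i < length p" for dx i
    using run_procedure_nth_step[of i p _ "inputs e dx"] that
    by (simp add: step_take[OF operands_bound])
  have cont: "continuous_on UNIV (\<lambda>dx. ?S dx ! k)" if "k < CARD('n) + length p" for k
    using that
  proof (induction k rule: value_induct)
    case (input k)
    then show ?case
      by (simp add: run_procedure_nth_input nth_inputs continuous_on_component)
  next
    case (instr i)
    then show ?case
      unfolding step[OF instr(1)] by (cases "p ! i") (auto intro!: continuous_intros)
  qed
  have "continuous_on UNIV (\<lambda>dx. secant_increment e p xc xh dx $ j)" for j
    unfolding secant_increment_def using outputs_nth(1)[of "?S dx" j for dx] cont[OF outputs_nth(2)[of "?S 0" j]]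
    by simp
  then have "continuous_on UNIV (\<lambda>dx. \<chi> j. secant_increment e p xc xh dx $ j)"
    by (intro continuous_on_vec_lambda)
  then have "continuous_on UNIV (secant_increment e p xc xh)"
    by simp
  then have "continuous_on S (\<lambda>x. secant_increment e p xc xh (x - midpoint xc xh))"
    by (rule continuous_on_compose2) (auto intro: continuous_on_diff continuous_on_id continuous_on_const)
  then show ?thesis
    unfolding secant_linearization_def by (intro continuous_on_add continuous_on_const)
qed

text \<open>The filter lets both reference points tend to \<open>xs\<close> while \<open>x\<close>
  ranges over all of \<open>K\<close>; the principal filter is what makes the constant uniform in
  \<open>x\<close>. Errors of order \<open>M\<close> propagate through each instruction.\<close>

lemma secant_tangent_linearization_bigo:
  fixes F :: "real ^ 'n \<Rightarrow> real ^ 'n"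
  assumes F: "computed_by e p F" and defined: "\<forall>\<^sub>F x in nhds xs. proc_defined_at e p x"
    and K: "bounded K"
  shows "(\<lambda>(xc, xh, x). norm (secant_linearization e p F xc xh x - tangent_linearization e p F xs x))
    \<in> O[nhds xs \<times>\<^sub>F (nhds xs \<times>\<^sub>F principal K)](\<lambda>(xc, xh, x). norm (xc - xs) + norm (xh - xs))"
proof -
  define \<F> where "\<F> = nhds xs \<times>\<^sub>F (nhds xs \<times>\<^sub>F principal K)"
  define M where "M z = norm (fst z - xs) + norm (fst (snd z) - xs)" for z :: "(real^'n) \<times> (real^'n) \<times> (real^'n)"
  define v where "v k = proc_values e p xs ! k" for k
  define a where "a k z = proc_values e p (fst z) ! k" for k and z :: "(real^'n) \<times> (real^'n) \<times> (real^'n)"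
  define b where "b k z = proc_values e p (fst (snd z)) ! k" for k and z :: "(real^'n) \<times> (real^'n) \<times> (real^'n)"
  define Sl where "Sl z = run_procedure (secant_step (proc_values e p (fst z)) (proc_values e p (fst (snd z)))) p
    (inputs e (snd (snd z) - midpoint (fst z) (fst (snd z))))" for z :: "(real^'n) \<times> (real^'n) \<times> (real^'n)"
  define Tl where "Tl z = run_procedure (tangent_step (proc_values e p xs)) p (inputs e (snd (snd z) - xs))"
    for z :: "(real^'n) \<times> (real^'n) \<times> (real^'n)"
  define S where "S k z = Sl z ! k" for k z
  define T where "T k z = Tl z ! k" for k z
  have S_step: "S (CARD('n) + i) z = secant_step (proc_values e p (fst z)) (proc_values e p (fst (snd z))) (Sl z) (p ! i)"
    if "i < length p" for i z
    unfolding S_def Sl_def using run_procedure_nth_step[of i p _ "inputs e dx" for dx] that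
    by (simp add: step_take[OF operands_bound])
  have T_step: "T (CARD('n) + i) z = tangent_step (proc_values e p xs) (Tl z) (p ! i)"
    if "i < length p" for i z
    unfolding T_def Tl_def using run_procedure_nth_step[of i p _ "inputs e dx" for dx] that
    by (simp add: step_take[OF operands_bound])
  have S_input: "S k z = (snd (snd z) - midpoint (fst z) (fst (snd z))) $ e k" if "k < CARD('n)" for k z
    using that by (simp add: S_def Sl_def run_procedure_nth_input nth_inputs)
  have T_input: "T k z = (snd (snd z) - xs) $ e k" if "k < CARD('n)" for k z
    using that by (simp add: T_def Tl_def run_procedure_nth_input nth_inputs)

  have lim: "filterlim fst (nhds xs) \<F>" "filterlim (\<lambda>z. fst (snd z)) (nhds xs) \<F>"
    unfolding \<F>_def by (auto intro: filterlim_fst filterlim_compose[OF filterlim_fst filterlim_snd])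
  have M0: "(M \<longlongrightarrow> 0) \<F>"
    unfolding M_def by (rule tendsto_eq_intros lim refl | simp)+
  have defined_xs: "proc_defined_at e p xs"
    using defined by (rule eventually_nhds_x_imp_x)

  have vals: "(\<lambda>z. a k z - v k) \<in> O[\<F>](M) \<and> (\<lambda>z. b k z - v k) \<in> O[\<F>](M)"
    if "k < CARD('n) + length p" for k
    using that
  proof (induction k rule: value_induct)
    case (input k)
    have "\<bar>a k z - v k\<bar> \<le> M z \<and> \<bar>b k z - v k\<bar> \<le> M z" for z
      using component_le_norm_cart[of "fst z - xs" "e k"] component_le_norm_cart[of "fst (snd z) - xs" "e k"]
        norm_ge_zero[of "fst z - xs"] norm_ge_zero[of "fst (snd z) - xs"]
      unfolding a_def b_def v_def M_def proc_values_input[OF input] vector_minus_component by linarith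
    then show ?case
      by (auto intro: bigo_real_bound[OF landau_o.big_refl])
  next
    case (instr i)
    define k where "k = CARD('n) + i"
    have IH: "(\<lambda>z. a j z - v j) \<in> O[\<F>](M)" "(\<lambda>z. b j z - v j) \<in> O[\<F>](M)"
      if "j \<in> operands (p ! i)" for j
      using instr(2)[OF that] by auto
    have eqs: "a k z = eval_step (proc_values e p (fst z)) (p ! i)"
      "b k z = eval_step (proc_values e p (fst (snd z))) (p ! i)"
      "v k = eval_step (proc_values e p xs) (p ! i)" for z
      by (simp_all add: a_def b_def v_def k_def proc_values_step[OF instr(1)])
    have "(\<lambda>z. a k z - v k) \<in> O[\<F>](M) \<and> (\<lambda>z. b k z - v k) \<in> O[\<F>](M)"
    proof (cases "p ! i")
      case (Const c)
      then show ?thesis by (simp add: eqs)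
    next
      case (Add j l)
      then show ?thesis
        using sum_in_bigo(1)[OF IH(1)[of j] IH(1)[of l]] sum_in_bigo(1)[OF IH(2)[of j] IH(2)[of l]]
        by (simp add: eqs a_def[symmetric] b_def[symmetric] v_def[symmetric] algebra_simps)
    next
      case (Sub j l)
      then show ?thesis
        using sum_in_bigo(2)[OF IH(1)[of j] IH(1)[of l]] sum_in_bigo(2)[OF IH(2)[of j] IH(2)[of l]]
        by (simp add: eqs a_def[symmetric] b_def[symmetric] v_def[symmetric] algebra_simps)
    next
      case (Mul j l)
      then show ?thesis
        using bigo_mult_diff[OF IH(1)[of j] IH(1)[of l] _ _ M0] bigo_mult_diff[OF IH(2)[of j] IH(2)[of l] _ _ M0]
        by (simp add: eqs a_def[symmetric] b_def[symmetric] v_def[symmetric])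
    next
      case (Elem D \<phi> j)
      have el: "elemental D \<phi>" using elemental_instr[OF instr(1) Elem] .
      have vD: "v j \<in> D"
        using defined_xs nth_mem[OF instr(1)] by (auto simp: proc_defined_at_def Elem v_def)
      have "(\<lambda>z. \<phi> (f z) - \<phi> (v j)) \<in> O[\<F>](M)" if f: "(\<lambda>z. f z - v j) \<in> O[\<F>](M)" for f
      proof -
        \<comment> \<open>Freezing one end of the secant at \<open>v j\<close> writes the change of
          \<phi> as a slope times \<open>f z - v j\<close>, and the product estimate applies with
          second comparison factor 0.\<close>
        have "(\<lambda>z. secant_slope \<phi> (v j) (f z) * (f z - v j) - deriv \<phi> (v j) * 0) \<in> O[\<F>](M)"
          using elemental_secant_slope_bigo[OF el vD _ f M0, of "\<lambda>_. v j"] f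
          by (intro bigo_mult_diff M0) auto
        moreover have "secant_slope \<phi> (v j) (f z) * (f z - v j) = \<phi> (f z) - \<phi> (v j)" for z
          by (auto simp: secant_slope_def)
        ultimately show ?thesis by simp
      qed
      then show ?thesis
        using IH[of j] Elem by (simp add: eqs a_def[symmetric] b_def[symmetric] v_def[symmetric])
    next
      case (Abs j)
      have "(\<lambda>z. \<bar>f z\<bar> - \<bar>v j\<bar>) \<in> O[\<F>](M)" if "(\<lambda>z. f z - v j) \<in> O[\<F>](M)" for f
      proof (rule bigo_real_bound)
        show "(\<lambda>z. \<bar>f z - v j\<bar>) \<in> O[\<F>](M)" using that by simp
        show "\<bar>\<bar>f z\<bar> - \<bar>v j\<bar>\<bar> \<le> \<bar>f z - v j\<bar>" for z by (rule abs_triangle_ineq3)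
      qed
      then show ?thesis
        using IH[of j] Abs by (simp add: eqs a_def[symmetric] b_def[symmetric] v_def[symmetric])
    qed
    then show ?case by (simp add: k_def)
  qed

  \<comment> \<open>Boundedness of the tangent increments joins the induction because
    \<open>Mul\<close> and \<open>Elem\<close> multiply coefficient errors of order \<open>M\<close>
    by them. It starts from the boundedness of \<open>K\<close>.\<close>
  have increments: "(\<lambda>z. S k z - T k z) \<in> O[\<F>](M) \<and> T k \<in> O[\<F>](\<lambda>_. 1)"
    if "k < CARD('n) + length p" for k
    using that
  proof (induction k rule: value_induct)
    case (input k)
    have "\<bar>S k z - T k z\<bar> \<le> M z" for z
    proof -
      \<comment> \<open>At the inputs the two increments differ by the displacement of the midpoint
        from \<open>xs\<close>.\<close>
      have "S k z - T k z = - ((1/2) *\<^sub>R ((fst z - xs) + (fst (snd z) - xs))) $ e k"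
        by (simp add: S_input[OF input] T_input[OF input] midpoint_def algebra_simps)
      then have "\<bar>S k z - T k z\<bar> \<le> norm ((1/2) *\<^sub>R ((fst z - xs) + (fst (snd z) - xs)))"
        using component_le_norm_cart by (metis norm_minus_cancel vector_uminus_component)
      also have "\<dots> \<le> M z"
        using norm_triangle_ineq[of "fst z - xs" "fst (snd z) - xs"] norm_ge_zero[of "fst z - xs"]
          norm_ge_zero[of "fst (snd z) - xs"]
        unfolding M_def norm_scaleR by (simp only: abs_divide abs_one abs_numeral)
      finally show ?thesis .
    qed
    moreover have "T k \<in> O[\<F>](\<lambda>_. 1)"
    proof -
      obtain C where C: "\<And>x. x \<in> K \<Longrightarrow> norm x \<le> C" using K by (auto simp: bounded_iff)
      have "\<bar>T k z\<bar> \<le> C + norm xs" if "snd (snd z) \<in> K" for z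
        using C[OF that] component_le_norm_cart[of "snd (snd z) - xs" "e k"] norm_triangle_ineq4[of "snd (snd z)" xs]
        by (simp add: T_input[OF input])
      moreover have "filterlim (\<lambda>z. snd (snd z)) (principal K) \<F>"
        unfolding \<F>_def by (rule filterlim_compose[OF filterlim_snd filterlim_snd])
      ultimately show ?thesis
        by (intro bigoI[of _ "C + norm xs"]) (auto simp: filterlim_principal elim!: eventually_mono)
    qed
    ultimately show ?case
      by (auto intro: bigo_real_bound[OF landau_o.big_refl])
  next
    case (instr i)
    define k where "k = CARD('n) + i"
    have IH: "(\<lambda>z. S j z - T j z) \<in> O[\<F>](M)" "T j \<in> O[\<F>](\<lambda>_. 1)"
      "(\<lambda>z. a j z - v j) \<in> O[\<F>](M)" "(\<lambda>z. b j z - v j) \<in> O[\<F>](M)"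
      if "j \<in> operands (p ! i)" for j
      using instr(2)[OF that] vals[of j] operands_bound[OF instr(1)] that instr(1) by force+
    have mean: "(\<lambda>z. (a j z + b j z) / 2 - v j) \<in> O[\<F>](M)" if "j \<in> operands (p ! i)" for j
    proof -
      have "(\<lambda>z. ((a j z - v j) + (b j z - v j)) / 2) \<in> O[\<F>](M)"
        using sum_in_bigo(1)[OF IH(3,4)[OF that]] by simp
      then show ?thesis by (simp add: field_simps)
    qed
    have eqS: "S k z = secant_step (proc_values e p (fst z)) (proc_values e p (fst (snd z))) (Sl z) (p ! i)"
      and eqT: "T k z = tangent_step (proc_values e p xs) (Tl z) (p ! i)" for z
      by (simp_all add: k_def S_step[OF instr(1)] T_step[OF instr(1)])
    note fold = a_def[symmetric] b_def[symmetric] v_def[symmetric] S_def[symmetric] T_def[symmetric]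
    have Teq: "T k = (\<lambda>z. tangent_step (proc_values e p xs) (Tl z) (p ! i))"
      by (rule ext) (rule eqT)
    have "(\<lambda>z. S k z - T k z) \<in> O[\<F>](M) \<and> T k \<in> O[\<F>](\<lambda>_. 1)"
    proof (cases "p ! i")
      case (Const c)
      then show ?thesis by (simp add: eqS Teq)
    next
      case (Add j l)
      then show ?thesis
        using sum_in_bigo(1)[OF IH(1)[of j] IH(1)[of l]] sum_in_bigo(1)[OF IH(2)[of j] IH(2)[of l]]
        by (simp add: eqS Teq fold algebra_simps)
    next
      case (Sub j l)
      then show ?thesis
        using sum_in_bigo(2)[OF IH(1)[of j] IH(1)[of l]] sum_in_bigo(2)[OF IH(2)[of j] IH(2)[of l]]
        by (simp add: eqS Teq fold algebra_simps)
    next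
      case (Mul j l)
      have "(\<lambda>z. (a j z + b j z) / 2 * S l z - v j * T l z) \<in> O[\<F>](M)"
        "(\<lambda>z. S j z * ((a l z + b l z) / 2) - T j z * v l) \<in> O[\<F>](M)"
        using bigo_mult_diff[OF mean[of j] IH(1)[of l] _ _ M0] bigo_mult_diff[OF IH(1)[of j] mean[of l] _ _ M0]
          IH(2)[of j] IH(2)[of l] Mul by simp_all
      from sum_in_bigo(1)[OF this]
      have "(\<lambda>z. S k z - T k z) \<in> O[\<F>](M)"
        using Mul by (simp add: eqS eqT fold algebra_simps)
      moreover have "T k \<in> O[\<F>](\<lambda>_. 1)"
        using IH(2)[of j] IH(2)[of l] Mul
        by (auto simp: Teq fold mult.commute[of _ "v _"] intro!: sum_in_bigo)
      ultimately show ?thesis ..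
    next
      case (Elem D \<phi> j)
      have el: "elemental D \<phi>" using elemental_instr[OF instr(1) Elem] .
      have vD: "v j \<in> D"
        using defined_xs nth_mem[OF instr(1)] by (auto simp: proc_defined_at_def Elem v_def)
      have "(\<lambda>z. secant_slope \<phi> (a j z) (b j z) * S j z - deriv \<phi> (v j) * T j z) \<in> O[\<F>](M)"
        using elemental_secant_slope_bigo[OF el vD IH(3,4)[of j] M0] IH(1,2)[of j] Elem
        by (intro bigo_mult_diff M0) auto
      then show ?thesis
        using IH(2)[of j] Elem by (simp add: eqS Teq fold secant_slope_def cong: if_cong)
    next
      case (Abs j)
      have "(\<lambda>z. S k z - T k z) \<in> O[\<F>](M)"
      proof (rule bigo_real_bound)
        show "(\<lambda>z. \<bar>a j z - v j\<bar> + \<bar>b j z - v j\<bar> + \<bar>S j z - T j z\<bar>) \<in> O[\<F>](M)"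
          using IH[of j] Abs by (intro sum_in_bigo) auto
        \<comment> \<open>The secant rule subtracts the mean of two absolute values, so the reverse
          triangle inequality is used three times: for the shifted argument and for each reference
          value. Each of \<open>\<bar>x - w\<bar>\<close> and \<open>\<bar>y - w\<bar>\<close>
          enters twice with weight one half.\<close>
        have "\<bar>\<bar>(x + y) / 2 + s\<bar> - (\<bar>x\<bar> + \<bar>y\<bar>) / 2 - (\<bar>w + t\<bar> - \<bar>w\<bar>)\<bar> \<le> \<bar>x - w\<bar> + \<bar>y - w\<bar> + \<bar>s - t\<bar>"
          for x y s w t :: real
        proof -
          have tri: "\<bar>A / 2 + B / 2 + C\<bar> \<le> \<bar>A\<bar> / 2 + \<bar>B\<bar> / 2 + \<bar>C\<bar>" for A B C :: real
            by linarith
          have "(x + y) / 2 + s - (w + t) = (x - w) / 2 + (y - w) / 2 + (s - t)"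
            by (simp add: field_simps)
          then have 1: "\<bar>\<bar>(x + y) / 2 + s\<bar> - \<bar>w + t\<bar>\<bar> \<le> \<bar>x - w\<bar> / 2 + \<bar>y - w\<bar> / 2 + \<bar>s - t\<bar>"
            using order_trans[OF abs_triangle_ineq3[of "(x + y) / 2 + s" "w + t"]] tri by metis
          have comb: "\<bar>P - (X + Y) / 2 - (Q - W)\<bar> \<le> A + B + C"
            if "\<bar>P - Q\<bar> \<le> A / 2 + B / 2 + C" "\<bar>X - W\<bar> \<le> A" "\<bar>Y - W\<bar> \<le> B" for P Q X Y W A B C :: real
            using that unfolding abs_le_iff by (simp add: field_simps)
          show ?thesis
            by (rule comb[OF 1 abs_triangle_ineq3 abs_triangle_ineq3])
        qed
        then show "\<bar>S k z - T k z\<bar> \<le> \<bar>a j z - v j\<bar> + \<bar>b j z - v j\<bar> + \<bar>S j z - T j z\<bar>" for z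
          using Abs by (simp add: eqS eqT fold)
      qed
      moreover have "T k \<in> O[\<F>](\<lambda>_. 1)"
      proof (rule bigo_real_bound)
        show "(\<lambda>z. \<bar>T j z\<bar>) \<in> O[\<F>](\<lambda>_. 1)" using IH(2)[of j] Abs by simp
        show "\<bar>T k z\<bar> \<le> \<bar>T j z\<bar>" for z
          using abs_triangle_ineq3[of "v j + T j z" "v j"] Abs by (simp add: eqT fold)
      qed
      ultimately show ?thesis ..
    qed
    then show ?case by (simp add: k_def)
  qed

  define Q where "Q z = secant_linearization e p F (fst z) (fst (snd z)) (snd (snd z)) - tangent_linearization e p F xs (snd (snd z))" for z
  have comp: "(\<lambda>z. Q z $ j) \<in> O[\<F>](M)" for j
  proof -
    define k where "k = length p + inv_into {..<CARD('n)} e j"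
    have k: "k < CARD('n) + length p"
      using outputs_nth(2)[of "proc_values e p xs" j] by (simp add: k_def length_proc_values)
    \<comment> \<open>\<open>F\<close> is tied to the procedure only where the latter is defined,
      hence the eventual statements for the two moving reference points.\<close>
    have Fj: "F x $ j = proc_values e p x ! k" if "proc_defined_at e p x" for x
      using F that outputs_nth(1)[of "proc_values e p x" j] by (simp add: computed_by_def k_def length_proc_values)
    have "\<forall>\<^sub>F z in \<F>. proc_defined_at e p (fst z)" "\<forall>\<^sub>F z in \<F>. proc_defined_at e p (fst (snd z))"
      using lim defined by (auto simp: filterlim_iff)
    then have "\<forall>\<^sub>F z in \<F>. ((a k z - v k) + (b k z - v k)) / 2 + (S k z - T k z) = Q z $ j"
    proof eventually_elim
      case (elim z)
      have "secant_increment e p (fst z) (fst (snd z)) (snd (snd z) - midpoint (fst z) (fst (snd z))) $ j = S k z"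
        using outputs_nth(1)[of "Sl z" j] by (simp add: secant_increment_def Sl_def S_def k_def)
      moreover have "tangent_increment e p xs (snd (snd z) - xs) $ j = T k z"
        using outputs_nth(1)[of "Tl z" j] by (simp add: tangent_increment_def Tl_def T_def k_def)
      ultimately show ?case
        using elim defined_xs by (simp add: Fj Q_def secant_linearization_def tangent_linearization_def midpoint_def
          a_def b_def v_def field_simps)
    qed
    moreover have "(\<lambda>z. ((a k z - v k) + (b k z - v k)) / 2 + (S k z - T k z)) \<in> O[\<F>](M)"
    proof (rule sum_in_bigo(1))
      show "(\<lambda>z. ((a k z - v k) + (b k z - v k)) / 2) \<in> O[\<F>](M)"
        using sum_in_bigo(1)[OF conjunct1[OF vals[OF k]] conjunct2[OF vals[OF k]]] by simp
      show "(\<lambda>z. S k z - T k z) \<in> O[\<F>](M)"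
        using increments[OF k] by blast
    qed
    ultimately show ?thesis
      by (rule iffD1[OF landau_o.big.in_cong])
  qed
  have "(\<lambda>z. norm (Q z)) \<in> O[\<F>](M)"
  proof (rule bigo_real_bound)
    show "(\<lambda>z. \<Sum>j\<in>UNIV. \<bar>Q z $ j\<bar>) \<in> O[\<F>](M)"
      using comp by (intro big_sum_in_bigo) simp
    show "\<bar>norm (Q z)\<bar> \<le> (\<Sum>j\<in>UNIV. \<bar>Q z $ j\<bar>)" for z
      by (simp add: norm_le_l1_cart)
  qed
  then show ?thesis
    by (simp add: \<F>_def M_def[abs_def] Q_def[abs_def] case_prod_unfold)
qed

end

section \<open>Choice of the radii\<close>

theorem lemma3p3:
  fixes \<Phi> :: "(real set \<times> (real \<Rightarrow> real)) set"
    and e :: "nat \<Rightarrow> 'n::finite"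
    and p :: "instr list"
    and F :: "real ^ 'n \<Rightarrow> real ^ 'n"
    and U :: "(real ^ 'n) set"
    and xs :: "real ^ 'n"
  assumes "elemental_library \<Phi>"
    and "bij_betw e {..<CARD('n)} UNIV"
    and "procedure_over \<Phi> CARD('n) p"
    and "computed_by e p F"
    and "\<forall>\<^sub>F x in nhds xs. proc_defined_at e p x"
    and "open U"
    and "isolated_root_in F U xs"
    and "coherently_oriented_on U (tangent_linearization e p F xs)"
  shows "\<exists>r>0. \<exists>R>0. \<forall>\<alpha>. 0 < \<alpha> \<and> \<alpha> < 1 \<longrightarrow>
           (\<forall>xc\<in>ball xs ((1 - \<alpha>) * R). \<forall>xh\<in>ball xs ((1 - \<alpha>) * R).
              ball 0 (\<alpha> * r) \<subseteq> secant_linearization e p F xc xh ` U)"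
proof -
  note proc = assms(1-3)
  have "tangent_increment e p xs 0 = 0"
    by (rule tangent_increment_0[OF proc])
  then have root: "tangent_linearization e p F xs xs = 0"
    using assms(7) by (simp add: tangent_linearization_def isolated_root_in_def)
  have "xs \<in> U" using assms(7) by (simp add: isolated_root_in_def)
  from coherently_oriented_covering[OF assms(6) this root assms(8)]
  obtain \<rho> m where \<rho>: "0 < \<rho>" and m: "0 < m" and sub: "cball xs \<rho> \<subseteq> U"
    and cover: "\<And>Q (y :: real ^ 'n). continuous_on (cball xs \<rho>) Q \<Longrightarrow>
      (\<And>x. x \<in> cball xs \<rho> \<Longrightarrow> norm (Q x - tangent_linearization e p F xs x) + norm y \<le> m) \<Longrightarrow>
      \<exists>x\<in>cball xs \<rho>. Q x = y"
    by blast
  obtain C where C: "0 < C" and ev: "\<forall>\<^sub>F z in nhds xs \<times>\<^sub>F (nhds xs \<times>\<^sub>F principal (cball xs \<rho>)).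
      norm ((\<lambda>(xc, xh, x). norm (secant_linearization e p F xc xh x - tangent_linearization e p F xs x)) z)
      \<le> C * norm ((\<lambda>(xc, xh, x). norm (xc - xs) + norm (xh - xs)) z)"
    using landau_o.bigE[OF secant_tangent_linearization_bigo[OF proc assms(4,5) bounded_cball[of xs \<rho>]]] .
  \<comment> \<open>Unfolding the product filter separates the conditions on \<open>xc\<close>,
    \<open>xh\<close> and \<open>x\<close>; the one on \<open>x\<close> holds on the entire ball, so
    a single radius \<open>R0\<close> suffices for the reference points.\<close>
  obtain P1 P' where P1: "eventually P1 (nhds xs)"
    and P': "eventually P' (nhds xs \<times>\<^sub>F principal (cball xs \<rho>))"
    and bound1: "\<And>xc z. P1 xc \<Longrightarrow> P' z \<Longrightarrow>
      norm (secant_linearization e p F xc (fst z) (snd z) - tangent_linearization e p F xs (snd z))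
      \<le> C * (norm (xc - xs) + norm (fst z - xs))"
    using ev unfolding eventually_prod_filter[of _ "nhds xs" "nhds xs \<times>\<^sub>F principal (cball xs \<rho>)"] by auto
  obtain P2 P3 where P2: "eventually P2 (nhds xs)" and P3: "eventually P3 (principal (cball xs \<rho>))"
    and P23: "\<And>xh x. P2 xh \<Longrightarrow> P3 x \<Longrightarrow> P' (xh, x)"
    using P' unfolding eventually_prod_filter by auto
  obtain R0 where R0: "0 < R0" "\<And>x. dist x xs < R0 \<Longrightarrow> P1 x \<and> P2 x"
    using eventually_conj[OF P1 P2] unfolding eventually_nhds_metric by blast
  have bound: "norm (secant_linearization e p F xc xh x - tangent_linearization e p F xs x)
      \<le> C * (norm (xc - xs) + norm (xh - xs))"
    if "xc \<in> ball xs R0" "xh \<in> ball xs R0" "x \<in> cball xs \<rho>" for xc xh x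
    using bound1[of xc "(xh, x)"] P23[of xh x] P3 R0(2)[of xc] R0(2)[of xh] that
    by (simp add: eventually_principal dist_commute)
  \<comment> \<open>\<open>R0\<close> keeps the reference points where the estimate holds. The
    factor 2 accounts for there being two of them, each at distance less than
    \<open>(1 - \<alpha>) * R\<close>.\<close>
  define R where "R = min R0 (m / (2 * C))"
  have R: "0 < R" "R \<le> R0"
    using R0(1) m C by (auto simp: R_def)
  have "R \<le> m / (2 * C)"
    by (simp add: R_def)
  then have CR: "2 * C * R \<le> m"
    using C by (simp add: field_simps)
  \<comment> \<open>The witness for \<open>r\<close> is the covering margin \<open>m\<close>
    itself.\<close>
  have "ball 0 (\<alpha> * m) \<subseteq> secant_linearization e p F xc xh ` U"
    if \<alpha>: "0 < \<alpha>" "\<alpha> < 1" and x: "xc \<in> ball xs ((1 - \<alpha>) * R)" "xh \<in> ball xs ((1 - \<alpha>) * R)" for \<alpha> xc xh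
  proof
    fix y :: "real ^ 'n" assume y: "y \<in> ball 0 (\<alpha> * m)"
    have "(1 - \<alpha>) * R \<le> 1 * R"
      using \<alpha> R(1) by (intro mult_right_mono) auto
    then have xR: "xc \<in> ball xs R0" "xh \<in> ball xs R0"
      using x R(2) by auto
    have "C * (norm (xc - xs) + norm (xh - xs)) \<le> C * ((1 - \<alpha>) * R + (1 - \<alpha>) * R)"
      using x C by (intro mult_left_mono add_mono) (auto simp: dist_norm norm_minus_commute)
    also have "\<dots> = (1 - \<alpha>) * (2 * C * R)"
      by simp
    also have "\<dots> \<le> (1 - \<alpha>) * m"
      using CR \<alpha> by (intro mult_left_mono) auto
    finally have "C * (norm (xc - xs) + norm (xh - xs)) + norm y \<le> m"
      using y by (simp add: algebra_simps)
    then have "norm (secant_linearization e p F xc xh x - tangent_linearization e p F xs x) + norm y \<le> m"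
      if "x \<in> cball xs \<rho>" for x
      using bound[OF xR that] by linarith
    then have "\<exists>x\<in>cball xs \<rho>. secant_linearization e p F xc xh x = y"
      by (intro cover continuous_on_secant_linearization[OF proc])
    then show "y \<in> secant_linearization e p F xc xh ` U"
      using sub by blast
  qed
  then show ?thesis
    using m R(1) by blast
qed

end
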